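(* Let $\mathcal{A}=\{H_1,\ldots,H_l\}$ be a hyperplane arrangement in $\mathbb{C}\mathbb{P}^n$ with isolated non-normal crossings, such that each non-normal crossing point is contained in exactly $n+1$ hyperplanes of $\mathcal{A}$, which intersect in that single point. Let $\alpha_j$ be a linear form defining $H_j$. Then there exists an $n$-isotropic subspace $V\subseteq A^1$ of dimension $n$, not contained in any coordinate hyperplane, if and only if there exists a partition $\Pi=\Pi_1,\ldots,\Pi_{n+1}$ of $\mathcal{A}$ such that: (1) each element $\Pi_i$ of the partition contains the same number of hyperplanes; (2) there exists $(a_1,\ldots,a_{n+1})\in(\mathbb{C}\setminus\{0\})^{n+1}$ such that $a_1 f_1+\cdots+a_{n+1}f_{n+1}=0$, where $f_i=\prod_{H_j\in\Pi_i}\alpha_j$ is the product of the linear forms defining the hyperplanes in $\Pi_i$. Moreover, the subspace $V$ is generated by $$\left\{\sum_{H_j\in\Pi_i}x_j-\sum_{H_j\in\Pi_{n+1}}x_j \;\middle|\; 1\le i\le n\right\},$$ where $\Pi$ is the partition corresponding to $V$.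
   Context: Let $\mathcal{A}=\{H_1,\ldots,H_l\}$ be an arrangement of distinct hyperplanes in $\mathbb{C}\mathbb{P}^n$. Orlik-Solomon algebra: let $E$ be the exterior algebra of $A^1:=\mathbb{C}^l$ with canonical generators $x_1,\ldots,x_l$ (one for each hyperplane), and let $K$ be the ideal of $E$ generated by (i) the elements $\partial(x_{i_1}\wedge\cdots\wedge x_{i_m}):=\sum_{j=1}^m(-1)^j x_{i_1}\wedge\cdots\wedge x_{i_{j-1}}\wedge x_{i_{j+1}}\wedge\cdots\wedge x_{i_m}$ for all $H_{i_1},\ldots,H_{i_m}$ that intersect non-generically (i.e. with nonempty intersection of codimension less than $m$), and (ii) the monomials $x_{i_1}\wedge\cdots\wedge x_{i_m}$ with $H_{i_1}\cap\cdots\cap H_{i_m}=\emptyset$. The Orlik-Solomon algebra of the arrangement is $A=E/K$; it is graded, with homogeneous part of degree $i$ denoted $A^i$, and it is generated by $A^1$. A linear subspace $V\subseteq A^1$ is $k$-isotropic if the product in $A$ of any $k$ vectors of $V$ vanishes. A coordinate hyperplane of $A^1=\mathbb{C}^l$ is the set of vectors whose $x_i$-coefficient is $0$, for some fixed $i$. The arrangement has isolated non-normal crossings (INNC) if the set of points of $\mathbb{C}\mathbb{P}^n$ at which the union of the hyperplanes is not a normal crossing divisor is finite (a point $p$ is a normal crossing if the hyperplanes of the arrangement through $p$ are defined by linearly independent linear forms). The points of this finite set are the non-normal crossing points. *)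

theory Defs
  imports "HOL-Analysis.Analysis" "HOL-Algebra.QuotRing" "HOL-Library.Disjoint_Sets"
begin

text \<open>
  With \<^term>\<open>CARD('m) = n + 1\<close>, a point of complex projective \<open>n\<close>-space is a line through the
  origin of \<^typ>\<open>complex ^ 'm\<close>.
\<close>

definition proj_space :: "(complex ^ 'm) set set" where
  "proj_space = {p. vec.subspace p \<and> vec.dim p = 1}"

text \<open>A linear form is given by its vector of coefficients.\<close>

definition lin_form :: "complex ^ 'm \<Rightarrow> complex ^ 'm \<Rightarrow> complex" where
  "lin_form a z = (\<Sum>k\<in>UNIV. a $ k * z $ k)"

definition defines_hyperplane :: "complex ^ 'm \<Rightarrow> (complex ^ 'm) set set \<Rightarrow> bool" where
  "defines_hyperplane a h \<longleftrightarrow> a \<noteq> 0 \<and> h = {p \<in> proj_space. \<forall>z\<in>p. lin_form a z = 0}"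

definition hyperplane_meet :: "('l \<Rightarrow> (complex ^ 'm) set set) \<Rightarrow> 'l set \<Rightarrow> (complex ^ 'm) set set" where
  "hyperplane_meet H S = {p \<in> proj_space. \<forall>i\<in>S. p \<in> H i}"

text \<open>
  The union of a nonempty projective linear subspace \<open>X\<close>, regarded as a set of lines, is its affine
  cone, whose dimension exceeds that of \<open>X\<close> by one; so the codimension of \<open>X\<close> in projective space is
  the codimension of the cone.
\<close>

definition proj_codim :: "(complex ^ 'm) set set \<Rightarrow> nat" where
  "proj_codim X = CARD('m) - vec.dim (\<Union>X)"

definition through :: "('l \<Rightarrow> (complex ^ 'm) set set) \<Rightarrow> (complex ^ 'm) set \<Rightarrow> 'l set" where
  "through H p = {j. p \<in> H j}"

definition normal_crossing_at ::
    "('l \<Rightarrow> (complex ^ 'm) set set) \<Rightarrow> (complex ^ 'm) set \<Rightarrow> bool" where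
  "normal_crossing_at H p \<longleftrightarrow>
     (\<exists>a. (\<forall>j\<in>through H p. defines_hyperplane (a j) (H j)) \<and>
          inj_on a (through H p) \<and> vec.independent (a ` through H p))"

definition non_normal_crossings :: "('l \<Rightarrow> (complex ^ 'm) set set) \<Rightarrow> (complex ^ 'm) set set" where
  "non_normal_crossings H = {p \<in> proj_space. \<not> normal_crossing_at H p}"

definition INNC :: "('l \<Rightarrow> (complex ^ 'm) set set) \<Rightarrow> bool" where
  "INNC H \<longleftrightarrow> finite (non_normal_crossings H)"

text \<open>
  The exterior algebra on generators \<open>x\<^sub>i\<close>, \<open>i :: 'l\<close>, is realised on its standard basis: the vector
  \<^term>\<open>axis S 1\<close> of \<^typ>\<open>complex ^ ('l set)\<close> stands for the product of the \<open>x\<^sub>i\<close>, \<open>i \<in> S\<close>, in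
  increasing order.  The linear order on the index type serves only to fix this basis.  For disjoint
  \<open>T\<close> and \<open>U\<close>, \<open>x\<^sub>T \<and> x\<^sub>U = (-1)\<^sup>k x\<^bsub>T \<union> U\<^esub>\<close>, where \<open>k\<close> is the number of inversions between \<open>T\<close> and \<open>U\<close>.
\<close>

definition inversions :: "'l::linorder set \<Rightarrow> 'l set \<Rightarrow> nat" where
  "inversions T U = card {(t, u). t \<in> T \<and> u \<in> U \<and> u < t}"

definition wedge ::
    "complex ^ ('l::{finite,linorder} set) \<Rightarrow> complex ^ ('l set) \<Rightarrow> complex ^ ('l set)" where
  "wedge a b = (\<chi> S. \<Sum>T\<in>Pow S. (-1) ^ inversions T (S - T) * a $ T * b $ (S - T))"

definition ext_alg :: "(complex ^ ('l::{finite,linorder} set)) ring" where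
  "ext_alg = \<lparr>carrier = UNIV, mult = wedge, one = axis {} 1, zero = 0, add = (+)\<rparr>"

definition ext_gen :: "'l::{finite,linorder} \<Rightarrow> complex ^ ('l set)" where
  "ext_gen i = axis {i} 1"

definition ext_monomial :: "'l::{finite,linorder} list \<Rightarrow> complex ^ ('l set)" where
  "ext_monomial xs = foldr wedge (map ext_gen xs) (axis {} 1)"

text \<open>The sum is indexed from \<open>0\<close>, which accounts for the exponent \<^term>\<open>Suc j\<close>.\<close>

definition ext_boundary :: "'l::{finite,linorder} list \<Rightarrow> complex ^ ('l set)" where
  "ext_boundary xs =
     (\<Sum>j<length xs. (-1) ^ Suc j *s ext_monomial (take j xs @ drop (Suc j) xs))"

lemma inversions_Un_left:
  fixes T U W :: "'l::{finite,linorder} set"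
  assumes "T \<inter> U = {}"
  shows "inversions (T \<union> U) W = inversions T W + inversions U W"
proof -
  have "{(t, u). t \<in> T \<union> U \<and> u \<in> W \<and> u < t} =
      {(t, u). t \<in> T \<and> u \<in> W \<and> u < t} \<union> {(t, u). t \<in> U \<and> u \<in> W \<and> u < t}"
    by auto
  moreover have "{(t, u). t \<in> T \<and> u \<in> W \<and> u < t} \<inter> {(t, u). t \<in> U \<and> u \<in> W \<and> u < t} = {}"
    using assms by auto
  ultimately show ?thesis
    by (simp add: inversions_def card_Un_disjoint)
qed

lemma inversions_Un_right:
  fixes T U W :: "'l::{finite,linorder} set"
  assumes "U \<inter> W = {}"
  shows "inversions T (U \<union> W) = inversions T U + inversions T W"
proof -
  have "{(t, u). t \<in> T \<and> u \<in> U \<union> W \<and> u < t} =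
      {(t, u). t \<in> T \<and> u \<in> U \<and> u < t} \<union> {(t, u). t \<in> T \<and> u \<in> W \<and> u < t}"
    by auto
  moreover have "{(t, u). t \<in> T \<and> u \<in> U \<and> u < t} \<inter> {(t, u). t \<in> T \<and> u \<in> W \<and> u < t} = {}"
    using assms by auto
  ultimately show ?thesis
    by (simp add: inversions_def card_Un_disjoint)
qed

lemma inversions_empty [simp]: "inversions {} U = 0" "inversions T {} = 0"
  by (simp_all add: inversions_def)

lemma wedge_assoc: "wedge (wedge a b) c = wedge a (wedge b c)"
proof (subst vec_eq_iff, intro allI)
  fix S :: "'a set"
  let ?s = "\<lambda>T U. (-1 :: complex) ^ inversions T U"
  have "wedge (wedge a b) c $ S =
      (\<Sum>R\<in>Pow S. \<Sum>T\<in>Pow R. ?s R (S - R) * ?s T (R - T) * a $ T * b $ (R - T) * c $ (S - R))"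
    by (simp add: wedge_def sum_distrib_left sum_distrib_right mult.assoc)
  also have "\<dots> = (\<Sum>(R, T)\<in>Sigma (Pow S) Pow.
      ?s R (S - R) * ?s T (R - T) * a $ T * b $ (R - T) * c $ (S - R))"
    by (rule sum.Sigma) auto
  also have "\<dots> = (\<Sum>(T, U)\<in>Sigma (Pow S) (\<lambda>T. Pow (S - T)).
      ?s T (S - T) * ?s U (S - T - U) * a $ T * b $ U * c $ (S - T - U))"
  proof (rule sum.reindex_bij_witness[where i = "\<lambda>(T, U). (T \<union> U, T)" and j = "\<lambda>(R, T). (T, R - T)"],
      goal_cases)
    case (5 x)
    then obtain R T where x: "x = (R, T)" and sub: "T \<subseteq> R" "R \<subseteq> S" by auto
    have R: "T \<union> (R - T) = R" and ST: "(R - T) \<union> (S - R) = S - T" and SR: "S - T - (R - T) = S - R"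
      using sub by auto
    have "inversions R (S - R) = inversions T (S - R) + inversions (R - T) (S - R)"
      using inversions_Un_left[of T "R - T" "S - R"] R by auto
    moreover have "inversions T (S - T) = inversions T (R - T) + inversions T (S - R)"
      using inversions_Un_right[of "R - T" "S - R" T] ST by auto
    ultimately have "inversions T (S - T) + inversions (R - T) (S - R) =
        inversions R (S - R) + inversions T (R - T)"
      by simp
    then have "?s T (S - T) * ?s (R - T) (S - R) = ?s R (S - R) * ?s T (R - T)"
      by (metis power_add)
    then show ?case
      using SR by (simp add: x)
  qed auto
  also have "\<dots> = (\<Sum>T\<in>Pow S. \<Sum>U\<in>Pow (S - T).
      ?s T (S - T) * ?s U (S - T - U) * a $ T * b $ U * c $ (S - T - U))"
    by (rule sum.Sigma[symmetric]) auto
  also have "\<dots> = wedge a (wedge b c) $ S"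
    by (simp add: wedge_def sum_distrib_left sum_distrib_right mult_ac)
  finally show "wedge (wedge a b) c $ S = wedge a (wedge b c) $ S" .
qed

lemma wedge_one_left: "wedge (axis {} 1) b = b"
proof (subst vec_eq_iff, intro allI)
  fix S :: "'a set"
  have "wedge (axis {} 1) b $ S = (\<Sum>T\<in>Pow S. if T = {} then b $ S else 0)"
    unfolding wedge_def vec_lambda_beta by (rule sum.cong) (auto simp: axis_def)
  then show "wedge (axis {} 1) b $ S = b $ S" by simp
qed

lemma wedge_one_right: "wedge a (axis {} 1) = a"
proof (subst vec_eq_iff, intro allI)
  fix S :: "'a set"
  have "wedge a (axis {} 1) $ S = (\<Sum>T\<in>Pow S. if T = S then a $ S else 0)"
    unfolding wedge_def vec_lambda_beta by (rule sum.cong) (auto simp: axis_def)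
  then show "wedge a (axis {} 1) $ S = a $ S" by simp
qed

lemma wedge_add_left: "wedge (a + b) c = wedge a c + wedge b c"
  by (simp add: vec_eq_iff wedge_def sum.distrib algebra_simps)

lemma wedge_add_right: "wedge c (a + b) = wedge c a + wedge c b"
  by (simp add: vec_eq_iff wedge_def sum.distrib algebra_simps)

lemma wedge_scale_left: "wedge (k *s a) b = k *s wedge a b"
  by (simp add: vec_eq_iff wedge_def sum_distrib_left mult_ac)

lemma wedge_scale_right: "wedge a (k *s b) = k *s wedge a b"
  by (simp add: vec_eq_iff wedge_def sum_distrib_left mult_ac)

lemma ring_ext_alg: "ring ext_alg"
proof (rule ringI)
  show "abelian_group ext_alg"
  proof (rule abelian_groupI)
    show "\<exists>y\<in>carrier ext_alg. y \<oplus>\<^bsub>ext_alg\<^esub> x = \<zero>\<^bsub>ext_alg\<^esub>" for x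
      by (rule bexI[of _ "- x"]) (auto simp: ext_alg_def)
  qed (auto simp: ext_alg_def add_ac)
  show "Group.monoid ext_alg"
    by (rule monoidI) (auto simp: ext_alg_def wedge_assoc wedge_one_left wedge_one_right)
qed (auto simp: ext_alg_def wedge_add_left wedge_add_right)

lemma wedge_axis:
  "wedge (axis T 1) (axis U 1) =
     (if T \<inter> U = {} then (-1) ^ inversions T U *s axis (T \<union> U) 1 else 0)"
proof (subst vec_eq_iff, intro allI)
  fix S :: "'a set"
  have "wedge (axis T 1) (axis U 1) $ S =
      (\<Sum>R\<in>Pow S. if R = T then (if S - T = U then (-1) ^ inversions T U else 0) else 0)"
    unfolding wedge_def vec_lambda_beta by (rule sum.cong) (auto simp: axis_def)
  also have "\<dots> = (if T \<subseteq> S \<and> S - T = U then (-1) ^ inversions T U else 0)"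
    by simp
  also have "T \<subseteq> S \<and> S - T = U \<longleftrightarrow> T \<inter> U = {} \<and> S = T \<union> U"
    by auto
  finally show "wedge (axis T 1) (axis U 1) $ S =
      (if T \<inter> U = {} then (-1) ^ inversions T U *s axis (T \<union> U) 1 else 0) $ S"
    by (auto simp: axis_def)
qed

lemma ext_gen_square: "wedge (ext_gen i) (ext_gen i) = 0"
  by (simp add: ext_gen_def wedge_axis)

lemma inversions_singletons: "inversions {i} {j} = (if j < i then 1 else 0)"
proof -
  have "{(t, u). t \<in> {i} \<and> u \<in> {j} \<and> u < t} = (if j < i then {(i, j)} else {})"
    by auto
  then show ?thesis by (simp add: inversions_def)
qed

lemma ext_gen_anticommute: "wedge (ext_gen i) (ext_gen j) = - wedge (ext_gen j) (ext_gen i)"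
  by (cases i j rule: linorder_cases)
    (auto simp: ext_gen_def wedge_axis inversions_singletons insert_commute)

lemma ext_monomial_sorted:
  "sorted_wrt (<) xs \<Longrightarrow> ext_monomial xs = axis (set xs) 1"
proof (induction xs)
  case (Cons i xs)
  then have "{(t, u). t \<in> {i} \<and> u \<in> set xs \<and> u < t} = {}" and "i \<notin> set xs"
    by auto
  then have "inversions {i} (set xs) = 0"
    unfolding inversions_def by (simp only: card.empty)
  then show ?case
    using Cons \<open>i \<notin> set xs\<close> by (simp add: ext_monomial_def ext_gen_def wedge_axis)
qed (simp add: ext_monomial_def)

definition os_relations ::
    "('l::{finite,linorder} \<Rightarrow> (complex ^ 'm) set set) \<Rightarrow> (complex ^ ('l set)) set" where
  "os_relations H =
     {ext_boundary xs | xs. distinct xs \<and> hyperplane_meet H (set xs) \<noteq> {} \<and>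
        proj_codim (hyperplane_meet H (set xs)) < length xs} \<union>
     {ext_monomial xs | xs. distinct xs \<and> hyperplane_meet H (set xs) = {}}"

definition os_ideal ::
    "('l::{finite,linorder} \<Rightarrow> (complex ^ 'm) set set) \<Rightarrow> (complex ^ ('l set)) set" where
  "os_ideal H = Idl\<^bsub>ext_alg\<^esub> (os_relations H)"

definition os_alg ::
    "('l::{finite,linorder} \<Rightarrow> (complex ^ 'm) set set) \<Rightarrow> (complex ^ ('l set)) set ring" where
  "os_alg H = ext_alg Quot (os_ideal H)"

text \<open>
  The degree-one part of the algebra is identified with \<^typ>\<open>complex ^ 'l\<close>, the generator \<open>x\<^sub>i\<close>
  corresponding to \<^term>\<open>axis i 1\<close>; the following map sends a vector to its class in the quotient.
\<close>

definition os_class ::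
    "('l::{finite,linorder} \<Rightarrow> (complex ^ 'm) set set) \<Rightarrow> (complex, 'l) vec \<Rightarrow> (complex ^ ('l set)) set"
  where "os_class H v = os_ideal H +>\<^bsub>ext_alg\<^esub> (\<Sum>i\<in>UNIV. v $ i *s ext_gen i)"

definition isotropic ::
    "('l::{finite,linorder} \<Rightarrow> (complex ^ 'm) set set) \<Rightarrow> nat \<Rightarrow> (complex, 'l) vec set \<Rightarrow> bool" where
  "isotropic H k V \<longleftrightarrow> vec.subspace V \<and>
     (\<forall>vs. length vs = k \<and> set vs \<subseteq> V \<longrightarrow>
        foldr (mult (os_alg H)) (map (os_class H) vs) \<one>\<^bsub>os_alg H\<^esub> = \<zero>\<^bsub>os_alg H\<^esub>)"

definition coordinate_hyperplane :: "'l::finite \<Rightarrow> (complex ^ 'l) set" where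
  "coordinate_hyperplane i = {v. v $ i = 0}"

definition full_isotropic ::
    "('l::{finite,linorder} \<Rightarrow> (complex ^ 'm) set set) \<Rightarrow> nat \<Rightarrow> (complex, 'l) vec set \<Rightarrow> bool" where
  "full_isotropic H n V \<longleftrightarrow>
     isotropic H n V \<and> vec.dim V = n \<and> (\<forall>i. \<not> V \<subseteq> coordinate_hyperplane i)"

text \<open>
  A linear relation between the products of linear forms is an identity of polynomials, equivalently
  of polynomial functions, the ground field being infinite.
\<close>

definition pencil_partition ::
    "('l::finite \<Rightarrow> complex ^ 'm) \<Rightarrow> nat \<Rightarrow> (nat \<Rightarrow> 'l set) \<Rightarrow> bool" where
  "pencil_partition \<alpha> n P \<longleftrightarrow>
     inj_on P {1..n+1} \<and> partition_on UNIV (P ` {1..n+1}) \<and>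
     (\<forall>i\<in>{1..n+1}. \<forall>j\<in>{1..n+1}. card (P i) = card (P j)) \<and>
     (\<exists>a :: nat \<Rightarrow> complex. (\<forall>i\<in>{1..n+1}. a i \<noteq> 0) \<and>
        (\<forall>z. (\<Sum>i=1..n+1. a i * (\<Prod>j\<in>P i. lin_form (\<alpha> j) z)) = 0))"

definition partition_generators :: "nat \<Rightarrow> (nat \<Rightarrow> 'l::finite set) \<Rightarrow> (complex ^ 'l) set" where
  "partition_generators n P =
     {(\<Sum>j\<in>P i. axis j 1) - (\<Sum>j\<in>P (n+1). axis j 1) | i. i \<in> {1..n}}"

end

theory Submission
  imports Defs
begin

text \<open>
  Call a circuit the set of the \<open>n + 1\<close> hyperplanes through a non-normal crossing point.  The
  hypotheses on the crossings force every family of hyperplanes that meets non-generically to be a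
  circuit, and two circuits with \<open>n\<close> hyperplanes in common coincide, since any \<open>n\<close> hyperplanes of a
  circuit already determine its point.  In degree \<open>n\<close> the Orlik-Solomon ideal is therefore spanned by
  the boundaries of the circuits, and these have pairwise disjoint supports in the standard basis.
  Whether a product of \<open>n\<close> vectors vanishes in the algebra can thus be read off from its coefficients,
  one circuit at a time: this is \<open>os_ideal_imp_circuit_condition\<close> and \<open>homogeneous_in_os_ideal\<close>.

  From a subspace to a partition.  Let \<open>V\<close> be \<open>n\<close>-isotropic of dimension \<open>n\<close> and regard the coordinates
  as vectors in the dual of \<open>V\<close>.  If the coordinates in \<open>T\<close> form a basis of this dual, the product of
  the basis of \<open>V\<close> dual to it has coefficient \<open>1\<close> at \<open>T\<close>; so \<open>T\<close> extends to a circuit, and the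
  coordinates of that circuit add up to zero on \<open>V\<close> (\<open>coordinate_basis_circuit\<close>).  Fix \<open>n - 1\<close>
  elements of \<open>T\<close>, spanning a hyperplane \<open>F\<close> of the dual.  Each coordinate \<open>j\<close> outside \<open>F\<close> completes
  them to a basis, and the last element of the resulting circuit is a partner of \<open>j\<close>; this pairing is
  an involution, and every pair has the same sum.  Summing over all pairs shows that the sum of all
  coordinates lies in each such \<open>F\<close>, so it is zero, and that the coordinates inside \<open>F\<close> add up to a
  multiple of the sum of any basis of \<open>F\<close> taken from the coordinates.  Exchanging one element of such
  a basis cannot change its sum, so the new element equals the old one (\<open>copies_of_exchange\<close>).  Hence
  \<open>F\<close> contains only repetitions of its \<open>n - 1\<close> basis elements, and counting gives each of them the
  same multiplicity, a fraction \<open>1 / (n + 1)\<close> of the number of hyperplanes.  So the coordinates take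
  exactly \<open>n + 1\<close> values, with sum zero, and equality of coordinates is the required partition.

  The relation between the products \<open>f\<^sub>1, \<dots>, f\<^bsub>n+1\<^esub>\<close> is a case of Max Noether's theorem: the common
  zeros of \<open>f\<^sub>1, \<dots>, f\<^sub>n\<close> are simple points, \<open>f\<^bsub>n+1\<^esub>\<close> vanishes at all of them and has the same degree,
  so it is a linear combination.  For products of linear forms this has an elementary proof by
  induction on the dimension of the slices cut out by some of the hyperplanes
  (\<open>last_product_in_span_on_slice\<close>).

  From a partition to a subspace.  By the relation, a point where \<open>n\<close> of the products vanish is a zero
  of the remaining one.  So any \<open>n\<close> hyperplanes of different classes extend to a circuit by a
  hyperplane of the missing class (\<open>transversal_extends_to_circuit\<close>).  The vectors spanned by the
  generators are constant on classes, so a product of \<open>n\<close> of them is supported on such transversals,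
  and on a circuit that meets every class it is proportional to the boundary.
\<close>

section \<open>Linear forms and their common zeros\<close>

lemma lin_form_add_left: "lin_form (a + b) z = lin_form a z + lin_form b z"
  by (simp add: lin_form_def sum.distrib algebra_simps)

lemma lin_form_add_right: "lin_form a (z + w) = lin_form a z + lin_form a w"
  by (simp add: lin_form_def sum.distrib algebra_simps)

lemma lin_form_scale_left: "lin_form (c *s a) z = c * lin_form a z"
  by (simp add: lin_form_def sum_distrib_left mult_ac)

lemma lin_form_scale_right: "lin_form a (c *s z) = c * lin_form a z"
  by (simp add: lin_form_def sum_distrib_left mult_ac)

lemma lin_form_zero [simp]: "lin_form 0 z = 0" "lin_form a 0 = 0"
  by (simp_all add: lin_form_def)

lemma lin_form_diff_left: "lin_form (a - b) z = lin_form a z - lin_form b z"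
  by (simp add: lin_form_def sum_subtractf algebra_simps)

lemma lin_form_diff_right: "lin_form a (z - w) = lin_form a z - lin_form a w"
  by (simp add: lin_form_def sum_subtractf algebra_simps)

lemma lin_form_commute: "lin_form a z = lin_form z a"
  by (simp add: lin_form_def mult.commute)

lemma lin_form_axis: "lin_form (axis k 1) z = z $ k"
proof -
  have "lin_form (axis k 1) z = (\<Sum>j\<in>UNIV. if j = k then z $ k else 0)"
    unfolding lin_form_def by (rule sum.cong) (auto simp: axis_def)
  then show ?thesis by simp
qed

lemma lin_form_eq_0_on_span:
  assumes "a \<in> vec.span A" "\<And>b. b \<in> A \<Longrightarrow> lin_form b z = 0"
  shows "lin_form a z = 0"
  using assms(1)
  by (induction rule: vec.span_induct_alt) (simp_all add: lin_form_add_left lin_form_scale_left assms(2))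

lemma subspace_common_kernel: "vec.subspace {z. \<forall>a\<in>A. lin_form a z = 0}"
  by (simp add: vec.subspace_def lin_form_add_right lin_form_scale_right)

text \<open>
  Extend a basis of the span of \<open>A\<close> by \<open>a\<close> and take a linear functional that is \<open>1\<close> at \<open>a\<close> and \<open>0\<close> on
  the basis.  Forms and points have the same type, so the functional is evaluation at a point.
\<close>

lemma exists_separating_point:
  fixes a :: "complex ^ 'm"
  assumes "a \<notin> vec.span A"
  obtains z where "\<forall>b\<in>A. lin_form b z = 0" "lin_form a z \<noteq> 0"
proof -
  obtain B where B: "B \<subseteq> A" "vec.independent B" "A \<subseteq> vec.span B"
    by (rule vec.basis_exists[of A])
  have a: "a \<notin> vec.span B"
    using assms B(1) vec.span_mono by blast
  then have "vec.independent (insert a B)"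
    using B(2) vec.independent_insert[of a B] by auto
  then obtain g where g: "Vector_Spaces.linear (*s) (*s) g"
    and gB: "\<forall>x\<in>insert a B. g x = (if x = a then (\<chi> i. 1) else (0 :: complex ^ 'm))"
    using vec.linear_independent_extend[of "insert a B" "\<lambda>x. if x = a then (\<chi> i. 1) else (0 :: complex ^ 'm)"]
    by auto
  let ?k = "undefined :: 'm"
  define z where "z = (\<chi> i. g (axis i 1) $ ?k)"
  have form: "lin_form x z = g x $ ?k" for x
  proof -
    have "g x = g (\<Sum>i\<in>UNIV. x $ i *s axis i 1)"
      by (simp add: basis_expansion)
    also have "\<dots> = (\<Sum>i\<in>UNIV. x $ i *s g (axis i 1))"
      by (simp add: vec.linear_sum[OF g] vec.linear_scale[OF g])
    finally show ?thesis
      by (simp add: lin_form_def z_def sum_component)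
  qed
  have "a \<notin> B" using a vec.span_base by blast
  then have "\<forall>b\<in>B. lin_form b z = 0"
    using gB by (auto simp: form)
  then have "\<forall>b\<in>A. lin_form b z = 0"
    using B(3) lin_form_eq_0_on_span by blast
  moreover have "lin_form a z \<noteq> 0"
    using gB by (auto simp: form)
  ultimately show ?thesis using that by blast
qed

lemma exists_nonzero_solution:
  fixes A :: "(complex ^ 'm) set"
  assumes "finite A" "card A < CARD('m)"
  obtains z where "z \<noteq> 0" "\<forall>a\<in>A. lin_form a z = 0"
proof -
  have "vec.span A \<noteq> UNIV"
  proof
    assume "vec.span A = UNIV"
    then have "vec.dim (UNIV :: (complex ^ 'm) set) \<le> card A"
      using vec.dim_le_card[of UNIV A] assms by simp
    then show False
      using assms by (simp add: card_cart_basis)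
  qed
  then obtain a where "a \<notin> vec.span A" by auto
  then obtain z where "\<forall>b\<in>A. lin_form b z = 0" "lin_form a z \<noteq> 0"
    by (rule exists_separating_point)
  moreover from this have "z \<noteq> 0" by auto
  ultimately show ?thesis using that by blast
qed

text \<open>
  A vector space over an infinite field is not a finite union of proper subspaces.  The induction moves
  along a line, where each form excludes at most one point.
\<close>

lemma exists_common_nonzero:
  assumes "finite B" "vec.subspace U" "\<And>b. b \<in> B \<Longrightarrow> \<exists>z\<in>U. lin_form b z \<noteq> 0"
  shows "\<exists>w\<in>U. \<forall>b\<in>B. lin_form b w \<noteq> 0"
  using assms(1,3)
proof (induction B)
  case empty
  then show ?case using assms(2) vec.subspace_0 by auto
next
  case (insert b B)
  then obtain w u where w: "w \<in> U" "\<forall>c\<in>B. lin_form c w \<noteq> 0" and u: "u \<in> U" "lin_form b u \<noteq> 0"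
    by (meson insertCI)
  obtain s where s: "s \<notin> (\<lambda>c. - lin_form c w / lin_form c u) ` insert b B"
    using ex_new_if_finite[OF infinite_UNIV_char_0] insert.hyps(1) by (meson finite_imageI finite_insert)
  have "lin_form c (w + s *s u) \<noteq> 0" if c: "c \<in> insert b B" for c
  proof
    assume *: "lin_form c (w + s *s u) = 0"
    then have eq: "lin_form c w + s * lin_form c u = 0"
      by (simp add: lin_form_add_right lin_form_scale_right)
    show False
    proof (cases "lin_form c u = 0")
      case True
      then show False using eq c w u by auto
    next
      case False
      then have "s = - lin_form c w / lin_form c u"
        using eq by (simp add: field_simps eq_neg_iff_add_eq_0)
      then show False using s c by blast
    qed
  qed
  moreover have "w + s *s u \<in> U"
    using w u assms(2) by (simp add: vec.subspace_add vec.subspace_scale)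
  ultimately show ?case by blast
qed

section \<open>Homogeneous functions divisible by linear forms\<close>

text \<open>
  The restriction of a homogeneous polynomial of degree \<open>d\<close> to the line through \<open>z\<close> in direction \<open>w\<close> has
  degree at most \<open>d\<close>, with the value at \<open>w\<close> as its coefficient of degree \<open>d\<close>.  The divisibility
  argument below uses a polynomial only through this property.
\<close>

definition homogeneous :: "nat \<Rightarrow> (complex ^ 'm \<Rightarrow> complex) \<Rightarrow> bool" where
  "homogeneous d g \<longleftrightarrow>
     (\<forall>z w. \<exists>p. degree p \<le> d \<and> coeff p d = g w \<and> (\<forall>t. poly p t = g (z + t *s w)))"

lemma homogeneousE:
  assumes "homogeneous d g"
  obtains p where "degree p \<le> d" "coeff p d = g w" "\<And>t. poly p t = g (z + t *s w)"
  using assms unfolding homogeneous_def by blast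

lemma homogeneous_prod_lin_form:
  assumes "finite A"
  shows "homogeneous (card A) (\<lambda>z. \<Prod>h\<in>A. lin_form (\<alpha> h) z)"
  unfolding homogeneous_def
proof (intro allI)
  fix z w
  define p where "p = (\<Prod>h\<in>A. [:lin_form (\<alpha> h) z, lin_form (\<alpha> h) w:])"
  have "degree p \<le> card A \<and> coeff p (card A) = (\<Prod>h\<in>A. lin_form (\<alpha> h) w)"
    unfolding p_def using assms
  proof (induction A)
    case (insert a A)
    let ?q = "\<Prod>h\<in>A. [:lin_form (\<alpha> h) z, lin_form (\<alpha> h) w:]"
    have "degree ([:lin_form (\<alpha> a) z, lin_form (\<alpha> a) w:] * ?q) \<le> 1 + card A"
      by (rule order_trans[OF degree_mult_le]) (use insert.IH in \<open>auto intro!: add_mono\<close>)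
    moreover have "coeff ?q (Suc (card A)) = 0"
      using insert.IH by (intro coeff_eq_0) (simp add: le_imp_less_Suc)
    ultimately show ?case
      using insert by simp
  qed simp
  moreover have "poly p t = (\<Prod>h\<in>A. lin_form (\<alpha> h) (z + t *s w))" for t
    by (simp add: p_def poly_prod lin_form_add_right lin_form_scale_right)
  ultimately show "\<exists>p. degree p \<le> card A \<and> coeff p (card A) = (\<Prod>h\<in>A. lin_form (\<alpha> h) w) \<and>
      (\<forall>t. poly p t = (\<Prod>h\<in>A. lin_form (\<alpha> h) (z + t *s w)))"
    by blast
qed

lemma homogeneous_diff_scale:
  assumes "homogeneous d f" "homogeneous d g"
  shows "homogeneous d (\<lambda>z. f z - c * g z)"
  unfolding homogeneous_def
proof (intro allI)
  fix z w
  obtain p where p: "degree p \<le> d" "coeff p d = f w" "\<And>t. poly p t = f (z + t *s w)"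
    using homogeneousE[OF assms(1), of w z] by blast
  obtain q where q: "degree q \<le> d" "coeff q d = g w" "\<And>t. poly q t = g (z + t *s w)"
    using homogeneousE[OF assms(2), of w z] by blast
  have "degree (p - smult c q) \<le> d"
    using p(1) q(1) by (intro degree_diff_le order_trans[OF degree_smult_le])
  then show "\<exists>p. degree p \<le> d \<and> coeff p d = f w - c * g w \<and>
      (\<forall>t. poly p t = f (z + t *s w) - c * g (z + t *s w))"
    using p q by (intro exI[of _ "p - smult c q"]) simp
qed

lemma homogeneous_diff_sum:
  assumes "finite K" "homogeneous d f" "\<And>i. i \<in> K \<Longrightarrow> homogeneous d (g i)"
  shows "homogeneous d (\<lambda>z. f z - (\<Sum>i\<in>K. c i * g i z))"
  using assms(1,3)
proof (induction K)
  case empty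
  then show ?case using assms(2) by simp
next
  case (insert k K)
  then have "homogeneous d (\<lambda>z. (f z - (\<Sum>i\<in>K. c i * g i z)) - c k * g k z)"
    by (intro homogeneous_diff_scale) auto
  then show ?case using insert.hyps by (simp add: algebra_simps)
qed

lemma poly_eq_scaled_of_roots:
  fixes p q :: "complex poly"
  assumes "degree p \<le> d" "degree q \<le> d" "coeff q d \<noteq> 0"
    and "finite R" "card R = d" "\<And>t. t \<in> R \<Longrightarrow> poly p t = 0" "\<And>t. t \<in> R \<Longrightarrow> poly q t = 0"
  shows "p = smult (coeff p d / coeff q d) q"
proof (rule ccontr)
  let ?c = "coeff p d / coeff q d"
  let ?r = "p - smult ?c q"
  assume "p \<noteq> smult ?c q"
  then have r: "?r \<noteq> 0" by simp
  have deg: "degree ?r \<le> d"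
    using assms(1,2) by (intro degree_diff_le order_trans[OF degree_smult_le])
  have "coeff ?r d = 0"
    using assms(3) by simp
  then have "degree ?r < d"
    using eq_zero_or_degree_less[OF deg] r by simp
  moreover have "R \<subseteq> {x. poly ?r x = 0}"
    using assms(6,7) by auto
  then have "card R \<le> card {x. poly ?r x = 0}"
    by (rule card_mono[OF poly_roots_finite[OF r]])
  then have "card R \<le> degree ?r"
    using card_poly_roots_bound[OF r] by simp
  ultimately show False using assms(5) by simp
qed

text \<open>
  A polynomial vanishing on distinct hyperplanes is divisible by their forms, and equality of degrees
  leaves a constant quotient.  Restrict to lines of a direction \<open>w\<close> on which no form vanishes: on a
  generic such line the zeros of the forms are distinct and determine \<open>g\<close> up to its leading
  coefficient.  The remaining points are limits of generic ones along a line in a generic direction,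
  where polynomials that agree outside a finite set are equal.
\<close>

lemma divisible_by_lin_forms:
  fixes g :: "complex ^ 'm \<Rightarrow> complex"
  assumes U: "vec.subspace U" and A: "finite A" and g: "homogeneous (card A) g"
    and van: "\<And>h z. h \<in> A \<Longrightarrow> z \<in> U \<Longrightarrow> lin_form (\<alpha> h) z = 0 \<Longrightarrow> g z = 0"
    and sep: "\<And>h h'. h \<in> A \<Longrightarrow> h' \<in> A \<Longrightarrow> h \<noteq> h' \<Longrightarrow>
                \<exists>z\<in>U. lin_form (\<alpha> h) z = 0 \<and> lin_form (\<alpha> h') z \<noteq> 0"
  shows "\<exists>c. \<forall>z\<in>U. g z = c * (\<Prod>h\<in>A. lin_form (\<alpha> h) z)"
proof (cases "\<exists>h\<in>A. \<forall>z\<in>U. lin_form (\<alpha> h) z = 0")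
  case True
  then show ?thesis using van by (intro exI[of _ 0]) auto
next
  case False
  let ?f = "\<lambda>z. \<Prod>h\<in>A. lin_form (\<alpha> h) z"
  obtain w where w: "w \<in> U" and "\<forall>b\<in>\<alpha> ` A. lin_form b w \<noteq> 0"
    using exists_common_nonzero[of "\<alpha> ` A" U] U A False by auto
  then have w0: "\<And>h. h \<in> A \<Longrightarrow> lin_form (\<alpha> h) w \<noteq> 0" by simp
  \<comment> \<open>A point where the form \<open>\<beta> (h, h')\<close> is nonzero lies on a line of direction \<open>w\<close> on which \<open>h\<close> and
    \<open>h'\<close> have different zeros.\<close>
  define \<beta> where "\<beta> = (\<lambda>(h, h'). lin_form (\<alpha> h') w *s \<alpha> h - lin_form (\<alpha> h) w *s \<alpha> h')"
  define B where "B = {(h, h'). h \<in> A \<and> h' \<in> A \<and> h \<noteq> h'}"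
  have "B \<subseteq> A \<times> A" by (auto simp: B_def)
  then have finB: "finite B" using A finite_subset by blast
  have \<beta>: "lin_form (\<beta> (h, h')) z =
      lin_form (\<alpha> h') w * lin_form (\<alpha> h) z - lin_form (\<alpha> h) w * lin_form (\<alpha> h') z" for h h' z
    by (simp add: \<beta>_def lin_form_diff_left lin_form_scale_left)
  have "\<exists>z\<in>U. lin_form b z \<noteq> 0" if b: "b \<in> \<beta> ` B" for b
  proof -
    obtain h h' where h: "h \<in> A" "h' \<in> A" "h \<noteq> h'" "b = \<beta> (h, h')"
      using b by (auto simp: B_def)
    then obtain z where "z \<in> U" "lin_form (\<alpha> h) z = 0" "lin_form (\<alpha> h') z \<noteq> 0"
      using sep by blast
    then show ?thesis
      using w0 h by (intro bexI[of _ z]) (auto simp: \<beta>)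
  qed
  then obtain u where u: "u \<in> U" "\<forall>b\<in>\<beta> ` B. lin_form b u \<noteq> 0"
    using exists_common_nonzero[of "\<beta> ` B" U] U finB by blast
  have f: "homogeneous (card A) ?f"
    by (rule homogeneous_prod_lin_form[OF A])
  have fw: "?f w \<noteq> 0" using w0 A by simp
  define c where "c = g w / ?f w"
  have generic: "g z = c * ?f z" if z: "z \<in> U" "\<And>b. b \<in> \<beta> ` B \<Longrightarrow> lin_form b z \<noteq> 0" for z
  proof -
    obtain p where p: "degree p \<le> card A" "coeff p (card A) = g w" "\<And>t. poly p t = g (z + t *s w)"
      using homogeneousE[OF g, of w z] by blast
    obtain q where q: "degree q \<le> card A" "coeff q (card A) = ?f w" "\<And>t. poly q t = ?f (z + t *s w)"
      using homogeneousE[OF f, of w z] by blast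
    \<comment> \<open>The parameter at which the line meets the hyperplane of \<open>h\<close>.\<close>
    define \<rho> where "\<rho> = (\<lambda>h. - lin_form (\<alpha> h) z / lin_form (\<alpha> h) w)"
    have inj: "inj_on \<rho> A"
    proof (rule inj_onI, rule ccontr)
      fix h h' assume h: "h \<in> A" "h' \<in> A" "\<rho> h = \<rho> h'" "h \<noteq> h'"
      then have "lin_form (\<beta> (h, h')) z \<noteq> 0" using z(2) by (auto simp: B_def)
      then show False
        using h w0 by (simp add: \<rho>_def \<beta> field_simps)
    qed
    have root: "lin_form (\<alpha> h) (z + \<rho> h *s w) = 0" if "h \<in> A" for h
      using w0[OF that] by (simp add: \<rho>_def lin_form_add_right lin_form_diff_right lin_form_scale_right)
    have inU: "z + t *s w \<in> U" for t
      using z w U by (simp add: vec.subspace_add vec.subspace_scale)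
    have "p = smult c q"
      unfolding c_def p(2)[symmetric] q(2)[symmetric]
    proof (rule poly_eq_scaled_of_roots[where R = "\<rho> ` A"])
      show "card (\<rho> ` A) = card A" using inj card_image by blast
      show "poly p t = 0" if "t \<in> \<rho> ` A" for t
        using that p(3) root inU van by auto
      show "poly q t = 0" if t: "t \<in> \<rho> ` A" for t
      proof -
        obtain h where "h \<in> A" "t = \<rho> h" using t by blast
        then have "?f (z + t *s w) = 0"
          using root A by (intro prod_zero) auto
        then show ?thesis using q(3) by simp
      qed
      show "coeff q (card A) \<noteq> 0" using q(2) fw by simp
    qed (rule p(1) q(1) finite_imageI[OF A])+
    then have "poly p 0 = c * poly q 0" by simp
    then show ?thesis using p(3) q(3) by simp
  qed
  have "g z = c * ?f z" if z: "z \<in> U" for z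
  proof -
    obtain p where p: "\<And>t. poly p t = g (z + t *s u)"
      using homogeneousE[OF g, of u z] by blast
    obtain q where q: "\<And>t. poly q t = ?f (z + t *s u)"
      using homogeneousE[OF f, of u z] by blast
    define bad where "bad = (\<lambda>b. - lin_form b z / lin_form b u) ` (\<beta> ` B)"
    have "poly (p - smult c q) t = 0" if t: "t \<notin> bad" for t
    proof -
      have "lin_form b (z + t *s u) \<noteq> 0" if b: "b \<in> \<beta> ` B" for b
      proof
        assume "lin_form b (z + t *s u) = 0"
        then have "lin_form b z + t * lin_form b u = 0"
          by (simp add: lin_form_add_right lin_form_scale_right)
        moreover have "lin_form b u \<noteq> 0" using u b by blast
        ultimately have "t = - lin_form b z / lin_form b u"
          by (simp add: field_simps eq_neg_iff_add_eq_0)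
        then show False using t b by (auto simp: bad_def)
      qed
      moreover have "z + t *s u \<in> U"
        using z u U by (simp add: vec.subspace_add vec.subspace_scale)
      ultimately show ?thesis using generic p q by simp
    qed
    then have "- bad \<subseteq> {t. poly (p - smult c q) t = 0}" by auto
    moreover have "infinite (- bad)"
      using finB infinite_UNIV_char_0[where 'a = complex] by (simp add: bad_def Compl_eq_Diff_UNIV)
    ultimately have "p - smult c q = 0"
      using poly_roots_finite finite_subset by blast
    then have "poly p 0 = c * poly q 0" by simp
    then show ?thesis using p q by simp
  qed
  then show ?thesis by blast
qed

section \<open>Circuits of the arrangement\<close>

lemma span_singleton_in_proj_space:
  fixes z :: "complex ^ 'm"
  assumes "z \<noteq> 0"
  shows "vec.span {z} \<in> proj_space"
  using assms by (simp add: proj_space_def vec.dim_singleton)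

lemma proj_spaceE:
  fixes p :: "(complex ^ 'm) set"
  assumes "p \<in> proj_space"
  obtains z where "z \<noteq> 0" "p = vec.span {z}"
proof -
  have p: "vec.subspace p" "vec.dim p = 1"
    using assms by (auto simp: proj_space_def)
  obtain B where B: "B \<subseteq> p" "vec.independent B" "p \<subseteq> vec.span B" "card B = vec.dim p"
    by (rule vec.basis_exists[of p])
  then obtain z where z: "B = {z}"
    using p(2) by (metis card_1_singletonE)
  have "z \<noteq> 0"
    using B(2) z vec.dependent_zero by blast
  moreover have "p = vec.span {z}"
    using B(1,3) p(1) z vec.span_minimal by blast
  ultimately show ?thesis using that by blast
qed

lemma span_singleton_in_hyperplane_iff:
  fixes z :: "complex ^ 'm"
  assumes "defines_hyperplane a h" "z \<noteq> 0"
  shows "vec.span {z} \<in> h \<longleftrightarrow> lin_form a z = 0"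
  using assms span_singleton_in_proj_space[OF assms(2)]
  by (auto simp: defines_hyperplane_def vec.span_singleton lin_form_scale_right vec.span_base
      intro: vec.span_base)

text \<open>
  A form outside the line of the other would be nonzero at some point of the common hyperplane.
\<close>

lemma defining_forms_proportional:
  fixes a b :: "complex ^ 'm"
  assumes "defines_hyperplane a h" "defines_hyperplane b h"
  shows "a \<in> vec.span {b}"
proof (rule ccontr)
  assume "a \<notin> vec.span {b}"
  then obtain z where z: "\<forall>c\<in>{b}. lin_form c z = 0" "lin_form a z \<noteq> 0"
    by (rule exists_separating_point)
  then have "z \<noteq> 0" by auto
  then show False
    using z span_singleton_in_hyperplane_iff[OF assms(1)] span_singleton_in_hyperplane_iff[OF assms(2)]
    by auto
qed

text \<open>
  Dependence of the indexed family, so that a repeated form counts as dependent; compare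
  \<open>dependent_forms_iff\<close>.
\<close>

definition dependent_forms :: "('l \<Rightarrow> complex ^ 'm) \<Rightarrow> 'l set \<Rightarrow> bool" where
  "dependent_forms \<alpha> S \<longleftrightarrow> (\<exists>s\<in>S. \<alpha> s \<in> vec.span (\<alpha> ` (S - {s})))"

lemma dependent_forms_mono:
  assumes "dependent_forms \<alpha> S" "S \<subseteq> S'"
  shows "dependent_forms \<alpha> S'"
proof -
  obtain s where s: "s \<in> S" "\<alpha> s \<in> vec.span (\<alpha> ` (S - {s}))"
    using assms(1) by (auto simp: dependent_forms_def)
  have "vec.span (\<alpha> ` (S - {s})) \<subseteq> vec.span (\<alpha> ` (S' - {s}))"
    using assms(2) by (intro vec.span_mono) auto
  then show ?thesis
    using s assms(2) by (auto simp: dependent_forms_def)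
qed

lemma dependent_forms_iff:
  "dependent_forms \<alpha> S \<longleftrightarrow> \<not> (inj_on \<alpha> S \<and> vec.independent (\<alpha> ` S))"
proof
  assume "dependent_forms \<alpha> S"
  then obtain s where s: "s \<in> S" "\<alpha> s \<in> vec.span (\<alpha> ` (S - {s}))"
    by (auto simp: dependent_forms_def)
  show "\<not> (inj_on \<alpha> S \<and> vec.independent (\<alpha> ` S))"
  proof
    assume *: "inj_on \<alpha> S \<and> vec.independent (\<alpha> ` S)"
    then have "\<alpha> ` (S - {s}) = \<alpha> ` S - {\<alpha> s}"
      using s(1) by (auto simp: inj_on_def)
    then show False
      using s * by (auto simp: vec.dependent_def)
  qed
next
  assume *: "\<not> (inj_on \<alpha> S \<and> vec.independent (\<alpha> ` S))"
  show "dependent_forms \<alpha> S"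
  proof (cases "inj_on \<alpha> S")
    case True
    then obtain s where s: "s \<in> S" "\<alpha> s \<in> vec.span (\<alpha> ` S - {\<alpha> s})"
      using * by (auto simp: vec.dependent_def)
    have "\<alpha> ` S - {\<alpha> s} \<subseteq> \<alpha> ` (S - {s})" by auto
    then show ?thesis
      using s vec.span_mono[of "\<alpha> ` S - {\<alpha> s}" "\<alpha> ` (S - {s})"]
      by (auto simp: dependent_forms_def)
  next
    case False
    then obtain s t where "s \<in> S" "t \<in> S" "s \<noteq> t" "\<alpha> s = \<alpha> t"
      by (auto simp: inj_on_def)
    then have "\<alpha> s \<in> \<alpha> ` (S - {s})" by (metis DiffI imageI singletonD)
    then have "\<alpha> s \<in> vec.span (\<alpha> ` (S - {s}))" by (rule vec.span_base)
    then show ?thesis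
      using \<open>s \<in> S\<close> unfolding dependent_forms_def by blast
  qed
qed

text \<open>
  Each new independent form is nonzero at some common zero of the earlier ones, so the space of common
  zeros strictly shrinks.
\<close>

lemma dim_common_kernel_le:
  fixes \<alpha> :: "'l \<Rightarrow> complex ^ 'm"
  assumes "finite S" "\<not> dependent_forms \<alpha> S"
  shows "vec.dim {z. \<forall>s\<in>S. lin_form (\<alpha> s) z = 0} + card S \<le> CARD('m)"
  using assms
proof (induction S)
  case empty
  then show ?case by (simp add: card_cart_basis)
next
  case (insert s S)
  let ?D = "\<lambda>S. {z. \<forall>s\<in>S. lin_form (\<alpha> s) z = 0}"
  have "vec.subspace (?D S)" for S
    using subspace_common_kernel[of "\<alpha> ` S"] by simp
  then have span: "vec.span (?D S) = ?D S" for S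
    by (rule vec.span_eq_iff[THEN iffD2])
  have "\<not> dependent_forms \<alpha> S"
    using insert.prems dependent_forms_mono[of \<alpha> S "insert s S"] by blast
  then have IH: "vec.dim (?D S) + card S \<le> CARD('m)"
    by (rule insert.IH)
  have "\<alpha> s \<notin> vec.span (\<alpha> ` S)"
    using insert.prems insert.hyps(2) by (auto simp: dependent_forms_def)
  then obtain z where "\<forall>b\<in>\<alpha> ` S. lin_form b z = 0" "lin_form (\<alpha> s) z \<noteq> 0"
    by (rule exists_separating_point)
  then have "?D (insert s S) \<subset> ?D S" by auto
  then have "vec.span (?D (insert s S)) \<subset> vec.span (?D S)"
    by (simp only: span)
  then have "vec.dim (?D (insert s S)) < vec.dim (?D S)"
    by (rule vec.dim_psubset)
  then show ?case
    using IH insert.hyps by simp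
qed

locale generic_innc_arrangement =
  fixes H :: "'l::{finite,linorder} \<Rightarrow> (complex ^ 'm) set set"
    and \<alpha> :: "'l \<Rightarrow> complex ^ 'm"
    and n :: nat
  assumes card_coordinates: "CARD('m) = n + 1"
    and inj_H: "inj H"
    and defines_H: "\<And>j. defines_hyperplane (\<alpha> j) (H j)"
    and isolated: "INNC H"
    and crossing: "\<And>p. p \<in> non_normal_crossings H \<Longrightarrow>
           card (through H p) = n + 1 \<and> hyperplane_meet H (through H p) = {p}"
begin

definition circuit :: "'l set \<Rightarrow> bool" where
  "circuit S \<longleftrightarrow> (\<exists>p\<in>non_normal_crossings H. S = through H p)"

text \<open>
  The hyperplanes through the point spanned by \<open>z\<close>.
\<close>

definition vanishing :: "complex ^ 'm \<Rightarrow> 'l set" where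
  "vanishing z = {j. lin_form (\<alpha> j) z = 0}"

lemma through_span: "z \<noteq> 0 \<Longrightarrow> through H (vec.span {z}) = vanishing z"
  by (simp add: through_def vanishing_def span_singleton_in_hyperplane_iff[OF defines_H])

lemma span_in_meet_iff:
  "z \<noteq> 0 \<Longrightarrow> vec.span {z} \<in> hyperplane_meet H S \<longleftrightarrow> S \<subseteq> vanishing z"
  by (auto simp: hyperplane_meet_def vanishing_def span_singleton_in_proj_space
      span_singleton_in_hyperplane_iff[OF defines_H])

lemma meet_nonempty_iff: "hyperplane_meet H S \<noteq> {} \<longleftrightarrow> (\<exists>z. z \<noteq> 0 \<and> S \<subseteq> vanishing z)"
proof
  assume "hyperplane_meet H S \<noteq> {}"
  then obtain p where p: "p \<in> hyperplane_meet H S" by auto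
  then have "p \<in> proj_space" by (simp add: hyperplane_meet_def)
  then obtain z where "z \<noteq> 0" "p = vec.span {z}" by (rule proj_spaceE)
  then show "\<exists>z. z \<noteq> 0 \<and> S \<subseteq> vanishing z"
    using p span_in_meet_iff by auto
qed (use span_in_meet_iff in blast)

text \<open>
  A normal crossing is witnessed by some independent choice of defining forms, but defining forms are
  unique up to scalars, so the given ones would be independent as well.
\<close>

lemma non_normal_if_dependent:
  assumes "z \<noteq> 0" "S \<subseteq> vanishing z" "dependent_forms \<alpha> S"
  shows "vec.span {z} \<in> non_normal_crossings H"
proof -
  let ?T = "vanishing z"
  have "dependent_forms \<alpha> ?T"
    using assms dependent_forms_mono by blast
  then obtain s where s: "s \<in> ?T" "\<alpha> s \<in> vec.span (\<alpha> ` (?T - {s}))"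
    by (auto simp: dependent_forms_def)
  have "\<not> normal_crossing_at H (vec.span {z})"
  proof
    assume "normal_crossing_at H (vec.span {z})"
    then obtain a where a: "\<forall>j\<in>?T. defines_hyperplane (a j) (H j)"
      and ind: "inj_on a ?T" "vec.independent (a ` ?T)"
      using assms(1) by (auto simp: normal_crossing_at_def through_span)
    have "\<alpha> j \<in> vec.span (a ` (?T - {s}))" if "j \<in> ?T - {s}" for j
      using that a defining_forms_proportional[OF defines_H, of "a j" j]
        vec.span_mono[of "{a j}" "a ` (?T - {s})"] by auto
    then have "vec.span (\<alpha> ` (?T - {s})) \<subseteq> vec.span (a ` (?T - {s}))"
      by (intro vec.span_minimal) auto
    then have "{\<alpha> s} \<subseteq> vec.span (a ` (?T - {s}))"
      using s by auto
    then have "vec.span {\<alpha> s} \<subseteq> vec.span (a ` (?T - {s}))"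
      by (intro vec.span_minimal) auto
    moreover have "a s \<in> vec.span {\<alpha> s}"
      using defining_forms_proportional[OF _ defines_H] a s by blast
    ultimately have "dependent_forms a ?T"
      using s by (auto simp: dependent_forms_def)
    then show False using ind dependent_forms_iff by blast
  qed
  then show ?thesis
    using assms(1) by (simp add: non_normal_crossings_def span_singleton_in_proj_space)
qed

lemma circuitE:
  assumes "circuit S"
  obtains z where "z \<noteq> 0" "S = vanishing z" "card S = n + 1" "dependent_forms \<alpha> S"
    "\<And>w. S \<subseteq> vanishing w \<Longrightarrow> w \<in> vec.span {z}"
proof -
  obtain p where p: "p \<in> non_normal_crossings H" "S = through H p"
    using assms by (auto simp: circuit_def)
  then obtain z where z: "z \<noteq> 0" "p = vec.span {z}"
    using proj_spaceE by (auto simp: non_normal_crossings_def)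
  have S: "S = vanishing z" using p z through_span by simp
  have "\<not> normal_crossing_at H p"
    using p by (simp add: non_normal_crossings_def)
  then have dep: "dependent_forms \<alpha> S"
    using defines_H p(2) unfolding dependent_forms_iff normal_crossing_at_def by blast
  have "w \<in> vec.span {z}" if w: "S \<subseteq> vanishing w" for w
  proof (cases "w = 0")
    case True
    then show ?thesis by (simp add: vec.span_zero)
  next
    case False
    then have "vec.span {w} \<in> hyperplane_meet H S"
      using w span_in_meet_iff by blast
    then have "vec.span {w} = vec.span {z}"
      using crossing[OF p(1)] p(2) z(2) by auto
    then show ?thesis
      using vec.span_base[of w "{w}"] by simp
  qed
  then show ?thesis
    using that z S dep crossing[OF p(1)] p(2) by auto
qed

lemma circuit_card: "circuit S \<Longrightarrow> card S = n + 1"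
  using circuitE by blast

lemma circuit_vanishing:
  assumes "z \<noteq> 0" "S \<subseteq> vanishing z" "dependent_forms \<alpha> S"
  shows "circuit (vanishing z)"
  using non_normal_if_dependent[OF assms] through_span[OF assms(1)] by (auto simp: circuit_def)

text \<open>
  If \<open>S\<close> had at most \<open>n\<close> elements, one of its forms being redundant would leave a common zero of \<open>S\<close> on
  every hyperplane of the ambient space; each of these is a non-normal crossing.  As there are only
  finitely many such crossings, some hyperplane avoids them all.  So \<open>S\<close> has at least \<open>n + 1\<close> elements,
  which is the number of all hyperplanes through the point.
\<close>

lemma dependent_forms_circuit:
  assumes "z \<noteq> 0" "S \<subseteq> vanishing z" "dependent_forms \<alpha> S"
  shows "circuit S"
proof -
  obtain s where s: "s \<in> S" "\<alpha> s \<in> vec.span (\<alpha> ` (S - {s}))"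
    using assms(3) by (auto simp: dependent_forms_def)
  let ?N = "non_normal_crossings H"
  have fin: "finite ?N" using isolated by (simp add: INNC_def)
  have "\<exists>x. x \<noteq> 0 \<and> p = vec.span {x}" if "p \<in> ?N" for p
    using that proj_spaceE by (auto simp: non_normal_crossings_def)
  then obtain x where x: "\<And>p. p \<in> ?N \<Longrightarrow> x p \<noteq> 0 \<and> p = vec.span {x p}"
    by metis
  have "\<exists>y\<in>UNIV. lin_form b y \<noteq> 0" if "b \<in> x ` ?N" for b
  proof -
    have "b \<noteq> 0" using that x by auto
    then obtain k where "b $ k \<noteq> 0" by (auto simp: vec_eq_iff)
    then show ?thesis
      by (intro bexI[of _ "axis k 1"]) (simp_all add: lin_form_commute[of b] lin_form_axis)
  qed
  \<comment> \<open>The roles of forms and points are exchanged here: \<open>g\<close> is a form vanishing at none of the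
    crossings.\<close>
  then obtain g where g: "\<And>p. p \<in> ?N \<Longrightarrow> lin_form (x p) g \<noteq> 0"
    using exists_common_nonzero[of "x ` ?N" UNIV] fin by auto
  have "\<not> card (S - {s}) < n"
  proof
    assume small: "card (S - {s}) < n"
    have "card (insert g (\<alpha> ` (S - {s}))) \<le> Suc (card (\<alpha> ` (S - {s})))"
      by (simp add: card_insert_if)
    also have "\<dots> \<le> Suc (card (S - {s}))"
      by (simp add: card_image_le)
    finally have "card (insert g (\<alpha> ` (S - {s}))) \<le> Suc (card (S - {s}))" .
    then have "card (insert g (\<alpha> ` (S - {s}))) < CARD('m)"
      using small card_coordinates by simp
    then obtain w where w: "w \<noteq> 0" "\<forall>a\<in>insert g (\<alpha> ` (S - {s})). lin_form a w = 0"
      using exists_nonzero_solution[of "insert g (\<alpha> ` (S - {s}))"] by auto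
    then have "lin_form (\<alpha> s) w = 0"
      using lin_form_eq_0_on_span[OF s(2)] by auto
    then have "S \<subseteq> vanishing w"
      using w by (auto simp: vanishing_def)
    then have "vec.span {w} \<in> ?N"
      using non_normal_if_dependent w(1) assms(3) by blast
    then have *: "vec.span {w} = vec.span {x (vec.span {w})}" and "lin_form (x (vec.span {w})) g \<noteq> 0"
      using x g by blast+
    moreover have "x (vec.span {w}) \<in> vec.span {w}"
      using vec.span_base[of "x (vec.span {w})" "{x (vec.span {w})}"] unfolding *[symmetric] by blast
    then obtain c where "x (vec.span {w}) = c *s w"
      by (auto simp: vec.span_singleton)
    moreover have "lin_form w g = 0"
      using w(2) lin_form_commute[of w g] by simp
    ultimately show False by (simp add: lin_form_scale_left)
  qed
  then have "n + 1 \<le> card S"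
    using card_Suc_Diff1[OF finite s(1)] by linarith
  moreover have "card (vanishing z) = n + 1"
    using circuit_card circuit_vanishing assms by blast
  ultimately have "S = vanishing z"
    using assms(2) by (intro card_seteq) auto
  then show ?thesis using circuit_vanishing assms by blast
qed

text \<open>
  Otherwise the dependence would already hold among the other \<open>n\<close> forms, and these would be a circuit of
  the wrong size.
\<close>

lemma circuit_span:
  assumes "circuit S" "s \<in> S"
  shows "\<alpha> s \<in> vec.span (\<alpha> ` (S - {s}))"
proof (rule ccontr)
  assume *: "\<alpha> s \<notin> vec.span (\<alpha> ` (S - {s}))"
  obtain z where z: "z \<noteq> 0" "S = vanishing z" "card S = n + 1" "dependent_forms \<alpha> S"
    by (rule circuitE[OF assms(1)])
  obtain t where t: "t \<in> S" "\<alpha> t \<in> vec.span (\<alpha> ` (S - {t}))"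
    using z(4) by (auto simp: dependent_forms_def)
  then have "s \<noteq> t" using * by auto
  have ins: "\<alpha> ` (S - {t}) = insert (\<alpha> s) (\<alpha> ` (S - {s} - {t}))"
    using \<open>s \<noteq> t\<close> assms(2) by auto
  have "\<alpha> t \<in> vec.span (\<alpha> ` (S - {s} - {t}))"
  proof (rule ccontr)
    assume "\<alpha> t \<notin> vec.span (\<alpha> ` (S - {s} - {t}))"
    then have "\<alpha> s \<in> vec.span (insert (\<alpha> t) (\<alpha> ` (S - {s} - {t})))"
      using t(2) unfolding ins by (rule vec.in_span_insert[rotated])
    moreover have "insert (\<alpha> t) (\<alpha> ` (S - {s} - {t})) = \<alpha> ` (S - {s})"
      using \<open>s \<noteq> t\<close> t(1) by auto
    ultimately show False using * by simp
  qed
  then have "dependent_forms \<alpha> (S - {s})"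
    using t(1) \<open>s \<noteq> t\<close> by (auto simp: dependent_forms_def)
  then have "circuit (S - {s})"
    using dependent_forms_circuit[OF z(1)] z(2) by blast
  then show False
    using circuit_card z(3) assms(2) by fastforce
qed

lemma vanishing_eq_circuit:
  assumes "circuit S" "T \<subseteq> S" "card T = n" "z \<noteq> 0" "T \<subseteq> vanishing z"
  shows "vanishing z = S"
proof -
  have "card (S - T) = 1"
    using assms circuit_card by (simp add: card_Diff_subset)
  then obtain s where s: "S - T = {s}" by (rule card_1_singletonE)
  then have T: "T = S - {s}" "s \<in> S" using assms(2) by auto
  have "lin_form (\<alpha> s) z = 0"
    using lin_form_eq_0_on_span[OF circuit_span[OF assms(1) T(2)]] assms(5) T(1)
    by (auto simp: vanishing_def)
  then have sub: "S \<subseteq> vanishing z"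
    using assms(5) T by (auto simp: vanishing_def)
  have "dependent_forms \<alpha> S"
    by (rule circuitE[OF assms(1)])
  then have "circuit (vanishing z)"
    using circuit_vanishing[OF assms(4) sub] by blast
  then show ?thesis
    using sub circuit_card assms(1) by (intro card_subset_eq[symmetric]) auto
qed

lemma circuit_unique:
  assumes "circuit S" "circuit S'" "T \<subseteq> S" "T \<subseteq> S'" "card T = n"
  shows "S = S'"
proof -
  obtain z where "z \<noteq> 0" "S' = vanishing z"
    by (rule circuitE[OF assms(2)])
  then show ?thesis
    using vanishing_eq_circuit[OF assms(1,3,5)] assms(4) by blast
qed

lemma circuit_point_unique:
  assumes "circuit S" "T \<subseteq> S" "card T = n" "T \<subseteq> vanishing z" "T \<subseteq> vanishing w" "z \<noteq> 0"
  shows "w \<in> vec.span {z}"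
proof (cases "w = 0")
  case False
  obtain y where y: "y \<noteq> 0" "S = vanishing y" "\<And>w. S \<subseteq> vanishing w \<Longrightarrow> w \<in> vec.span {y}"
    by (rule circuitE[OF assms(1)]) blast
  have "z \<in> vec.span {y}" "w \<in> vec.span {y}"
    using y(3) vanishing_eq_circuit[OF assms(1,2,3)] assms False by blast+
  then obtain a b where ab: "z = a *s y" "w = b *s y"
    by (auto simp: vec.span_singleton)
  then have "w = (b / a) *s z"
    using assms(6) by (simp add: vector_smult_assoc)
  then show ?thesis by (auto simp: vec.span_singleton)
qed (simp add: vec.span_zero)

text \<open>
  Proportional forms define equal hyperplanes, so one or two hyperplanes of the arrangement always
  cross normally.
\<close>

lemma circuit_imp_ge_2:
  assumes "circuit S"
  shows "n \<ge> 2"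
proof (rule ccontr)
  assume n: "\<not> n \<ge> 2"
  have nz: "\<alpha> j \<noteq> 0" for j
    using defines_H[of j] by (simp add: defines_hyperplane_def)
  have S: "card S = n + 1" by (rule circuit_card[OF assms])
  then obtain s where s: "s \<in> S" by fastforce
  have "card (S - {s}) = n"
    using s S by (simp add: card_Diff_singleton)
  then consider "S - {s} = {}" | t where "S - {s} = {t}"
    using n by (metis One_nat_def card_0_eq card_1_singletonE finite less_2_cases not_le)
  then show False
  proof cases
    case 1
    then show False using circuit_span[OF assms s] nz[of s] by (metis image_empty singletonD vec.span_empty)
  next
    case (2 t)
    then have "\<alpha> s \<in> vec.span {\<alpha> t}"
      using circuit_span[OF assms s] by simp
    then obtain c where c: "\<alpha> s = c *s \<alpha> t" by (auto simp: vec.span_singleton)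
    moreover have "c \<noteq> 0" using c nz[of s] by auto
    ultimately have "H s = H t"
      using defines_H[of s] defines_H[of t] by (simp add: defines_hyperplane_def lin_form_scale_left)
    then show False using inj_H 2 by (auto dest: injD)
  qed
qed

lemma Union_meet:
  assumes "hyperplane_meet H S \<noteq> {}"
  shows "\<Union>(hyperplane_meet H S) = {z. \<forall>s\<in>S. lin_form (\<alpha> s) z = 0}"
proof (intro equalityI subsetI)
  fix z assume "z \<in> \<Union>(hyperplane_meet H S)"
  then obtain p where p: "p \<in> hyperplane_meet H S" "z \<in> p" by auto
  then show "z \<in> {z. \<forall>s\<in>S. lin_form (\<alpha> s) z = 0}"
    using defines_H by (auto simp: hyperplane_meet_def defines_hyperplane_def)
next
  fix z assume z: "z \<in> {z. \<forall>s\<in>S. lin_form (\<alpha> s) z = 0}"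
  show "z \<in> \<Union>(hyperplane_meet H S)"
  proof (cases "z = 0")
    case True
    then show ?thesis
      using assms vec.subspace_0 by (auto simp: hyperplane_meet_def proj_space_def)
  next
    case False
    then have "vec.span {z} \<in> hyperplane_meet H S"
      using z by (auto simp: span_in_meet_iff vanishing_def)
    then show ?thesis using vec.span_base by blast
  qed
qed

text \<open>
  This identifies the first family of relations of the Orlik-Solomon algebra.
\<close>

lemma nongeneric_iff_circuit:
  "hyperplane_meet H S \<noteq> {} \<and> proj_codim (hyperplane_meet H S) < card S \<longleftrightarrow> circuit S"
proof
  assume *: "hyperplane_meet H S \<noteq> {} \<and> proj_codim (hyperplane_meet H S) < card S"
  then obtain z where z: "z \<noteq> 0" "S \<subseteq> vanishing z"
    using meet_nonempty_iff by blast
  have "\<not> vec.dim {z. \<forall>s\<in>S. lin_form (\<alpha> s) z = 0} + card S \<le> CARD('m)"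
    using * Union_meet[of S] by (auto simp: proj_codim_def)
  then have "dependent_forms \<alpha> S"
    using dim_common_kernel_le[of S \<alpha>] by auto
  then show "circuit S" using dependent_forms_circuit[OF z] by blast
next
  assume S: "circuit S"
  obtain z where z: "z \<noteq> 0" "S = vanishing z"
    by (rule circuitE[OF S])
  have ne: "hyperplane_meet H S \<noteq> {}"
    using z meet_nonempty_iff by blast
  have "{z} \<subseteq> \<Union>(hyperplane_meet H S)"
    unfolding Union_meet[OF ne] using z(2) by (auto simp: vanishing_def)
  then have "vec.dim {z} \<le> vec.dim (\<Union>(hyperplane_meet H S))"
    by (rule vec.dim_subset)
  then have "proj_codim (hyperplane_meet H S) < card S"
    using z(1) circuit_card[OF S] card_coordinates by (simp add: proj_codim_def vec.dim_singleton)
  then show "hyperplane_meet H S \<noteq> {} \<and> proj_codim (hyperplane_meet H S) < card S"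
    using ne by blast
qed

lemma exists_common_zero:
  assumes "card S \<le> n"
  obtains z where "z \<noteq> 0" "S \<subseteq> vanishing z"
proof -
  have "card (\<alpha> ` S) < CARD('m)"
    using card_image_le[of S \<alpha>] assms card_coordinates by simp
  then obtain z where "z \<noteq> 0" "\<forall>a\<in>\<alpha> ` S. lin_form a z = 0"
    using exists_nonzero_solution[of "\<alpha> ` S"] by auto
  then show ?thesis using that by (auto simp: vanishing_def)
qed

end

section \<open>Noether's theorem for products of linear forms\<close>

text \<open>
  What the proof of Noether's theorem needs of the partition: a point where \<open>n\<close> of the \<open>n + 1\<close> class
  products vanish is a zero of exactly one form in each class, and such a point is determined by the
  \<open>n\<close> forms that vanish there.
\<close>

locale net_of_forms =
  fixes \<alpha> :: "'l::finite \<Rightarrow> complex ^ 'm" and P :: "nat \<Rightarrow> 'l set" and n m :: nat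
  assumes card_coordinates: "CARD('m) = n + 1"
    and card_class: "\<And>i. i \<in> {1..n+1} \<Longrightarrow> card (P i) = m"
    and class_nonempty: "\<And>i. i \<in> {1..n+1} \<Longrightarrow> P i \<noteq> {}"
    and unique_member: "\<And>q z i. \<lbrakk>q \<in> {1..n+1}; z \<noteq> 0;
          \<And>i. i \<in> {1..n+1} - {q} \<Longrightarrow> \<exists>j\<in>P i. lin_form (\<alpha> j) z = 0; i \<in> {1..n+1}\<rbrakk>
          \<Longrightarrow> \<exists>!j. j \<in> P i \<and> lin_form (\<alpha> j) z = 0"
    and unique_point: "\<And>q r z w. \<lbrakk>q \<in> {1..n+1}; z \<noteq> 0;
          \<And>i. i \<in> {1..n+1} - {q} \<Longrightarrow> r i \<in> P i \<and> lin_form (\<alpha> (r i)) z = 0 \<and> lin_form (\<alpha> (r i)) w = 0\<rbrakk>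
          \<Longrightarrow> w \<in> vec.span {z}"
begin

definition class_product :: "nat \<Rightarrow> complex ^ 'm \<Rightarrow> complex" where
  "class_product i z = (\<Prod>j\<in>P i. lin_form (\<alpha> j) z)"

lemma class_product_eq_0_iff: "class_product i z = 0 \<longleftrightarrow> (\<exists>j\<in>P i. lin_form (\<alpha> j) z = 0)"
  by (simp add: class_product_def)

lemma exists_common_zero_of_few:
  assumes "card X \<le> n"
  obtains z where "z \<noteq> 0" "\<And>j. j \<in> X \<Longrightarrow> lin_form (\<alpha> j) z = 0"
proof -
  have "card (\<alpha> ` X) < CARD('m)"
    using card_image_le[of X \<alpha>] assms card_coordinates by simp
  then obtain z where "z \<noteq> 0" "\<forall>a\<in>\<alpha> ` X. lin_form a z = 0"
    using exists_nonzero_solution[of "\<alpha> ` X"] by auto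
  then show ?thesis using that by auto
qed

lemma exists_representatives:
  obtains s where "\<And>i. i \<in> {1..n+1} \<Longrightarrow> s i \<in> P i"
proof
  show "(SOME j. j \<in> P i) \<in> P i" if "i \<in> {1..n+1}" for i
    using class_nonempty[OF that] by (simp add: some_in_eq)
qed

text \<open>
  The slice is cut out by one form from each of the first \<open>n\<close> classes outside \<open>K\<close>; for empty \<open>K\<close> it is a
  single point, where the last product vanishes.  To add a class \<open>k\<close>, apply the induction hypothesis
  on the intersection of the slice with each hyperplane \<open>h\<close> of that class.  The coefficients found for
  two hyperplanes agree: at a common zero of both hyperplanes and of one form from every class of \<open>K\<close>
  except \<open>i\<close>, only the term of \<open>i\<close> survives, and it is not zero, for otherwise two forms of
  class \<open>k\<close> would vanish at a point where all of the first \<open>n\<close> products do.  So with common coefficients the difference vanishes on every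
  hyperplane of class \<open>k\<close> and is a multiple of the product of that class.
\<close>

lemma last_product_in_span_on_slice:
  assumes "finite K" "K \<subseteq> {1..n}" "\<And>i. i \<in> {1..n} - K \<Longrightarrow> r i \<in> P i"
  shows "\<exists>c. \<forall>z. (\<forall>i\<in>{1..n} - K. lin_form (\<alpha> (r i)) z = 0) \<longrightarrow>
           class_product (n + 1) z = (\<Sum>i\<in>K. c i * class_product i z)"
  using assms
proof (induction K arbitrary: r)
  case empty
  have "class_product (n + 1) z = 0" if z: "\<forall>i\<in>{1..n}. lin_form (\<alpha> (r i)) z = 0" for z
  proof (cases "z = 0")
    case True
    then show ?thesis
      using class_nonempty[of "n + 1"] by (auto simp: class_product_eq_0_iff)
  next
    case False
    have "\<exists>!j. j \<in> P (n + 1) \<and> lin_form (\<alpha> j) z = 0"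
    proof (rule unique_member[of "n + 1" z])
      fix i assume "i \<in> {1..n+1} - {n+1}"
      then have "i \<in> {1..n}" by auto
      then show "\<exists>j\<in>P i. lin_form (\<alpha> j) z = 0"
        using z empty.prems by (intro bexI[of _ "r i"]) auto
    qed (use False in auto)
    then show ?thesis by (auto simp: class_product_eq_0_iff)
  qed
  then show ?case by simp
next
  case (insert k K)
  let ?R = "{1..n} - insert k K"
  let ?f = class_product
  have k: "k \<in> {1..n}" "k \<notin> K" and K: "K \<subseteq> {1..n}" using insert.prems insert.hyps by auto
  have cardR: "card ?R + card K + 1 = n"
  proof -
    have "card ?R = n - card (insert k K)"
      using insert.prems(1) insert.hyps(1) by (subst card_Diff_subset) auto
    moreover have "card (insert k K) \<le> n"
      using card_mono[OF _ insert.prems(1)] by simp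
    ultimately show ?thesis using insert.hyps by simp
  qed
  obtain s where s: "\<And>i. i \<in> {1..n+1} \<Longrightarrow> s i \<in> P i"
    by (rule exists_representatives) blast
  have "\<forall>h\<in>P k. \<exists>c. \<forall>z. (\<forall>i\<in>?R. lin_form (\<alpha> (r i)) z = 0) \<and> lin_form (\<alpha> h) z = 0 \<longrightarrow>
          ?f (n + 1) z = (\<Sum>i\<in>K. c i * ?f i z)"
  proof
    fix h assume h: "h \<in> P k"
    have "(r(k := h)) i \<in> P i" if "i \<in> {1..n} - K" for i
      using that h insert.prems(2) by auto
    then obtain c where c: "\<And>z. (\<forall>i\<in>{1..n} - K. lin_form (\<alpha> ((r(k := h)) i)) z = 0) \<Longrightarrow>
        ?f (n + 1) z = (\<Sum>i\<in>K. c i * ?f i z)"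
      using insert.IH[OF K, of "r(k := h)"] by blast
    show "\<exists>c. \<forall>z. (\<forall>i\<in>?R. lin_form (\<alpha> (r i)) z = 0) \<and> lin_form (\<alpha> h) z = 0 \<longrightarrow>
          ?f (n + 1) z = (\<Sum>i\<in>K. c i * ?f i z)"
      by (intro exI[of _ c] allI impI c) auto
  qed
  then obtain C where C: "\<And>h z. \<lbrakk>h \<in> P k; \<And>i. i \<in> ?R \<Longrightarrow> lin_form (\<alpha> (r i)) z = 0;
      lin_form (\<alpha> h) z = 0\<rbrakk> \<Longrightarrow> ?f (n + 1) z = (\<Sum>i\<in>K. C h i * ?f i z)"
    by (auto simp: bchoice_iff)
  have one_in_class: False
    if "z \<noteq> 0" "h \<in> P k" "h' \<in> P k" "h \<noteq> h'" "lin_form (\<alpha> h) z = 0" "lin_form (\<alpha> h') z = 0"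
      "\<And>i. i \<in> {1..n} - {k} \<Longrightarrow> \<exists>j\<in>P i. lin_form (\<alpha> j) z = 0" for z h h'
  proof -
    have "\<exists>!j. j \<in> P k \<and> lin_form (\<alpha> j) z = 0"
    proof (rule unique_member[of "n + 1" z])
      show "\<exists>j\<in>P i. lin_form (\<alpha> j) z = 0" if "i \<in> {1..n+1} - {n+1}" for i
        using \<open>h \<in> P k\<close> \<open>lin_form (\<alpha> h) z = 0\<close> that(1) \<open>\<And>i. i \<in> {1..n} - {k} \<Longrightarrow> _\<close>[of i]
        by (cases "i = k") auto
    qed (use \<open>z \<noteq> 0\<close> k in auto)
    then show False using that by auto
  qed
  have C_eq: "C h i = C h' i" if h: "h \<in> P k" "h' \<in> P k" and i: "i \<in> K" for h h' i
  proof (cases "h = h'")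
    case False
    let ?X = "r ` ?R \<union> {h, h'} \<union> s ` (K - {i})"
    have "card ?X \<le> card (r ` ?R) + card {h, h'} + card (s ` (K - {i}))"
      by (intro order_trans[OF card_Un_le] add_right_mono card_Un_le)
    also have "\<dots> \<le> card ?R + 2 + card (K - {i})"
      using insert.hyps(1) by (intro add_mono card_image_le) (auto simp: card_insert_if)
    also have "\<dots> = n"
      using cardR card_Suc_Diff1[OF insert.hyps(1) i] by simp
    finally obtain z where z: "z \<noteq> 0" "\<And>j. j \<in> ?X \<Longrightarrow> lin_form (\<alpha> j) z = 0"
      by (rule exists_common_zero_of_few) blast
    have zR: "lin_form (\<alpha> (r t)) z = 0" if "t \<in> ?R" for t using z(2) that by blast
    have zK: "lin_form (\<alpha> (s t)) z = 0" if "t \<in> K - {i}" for t using z(2) that by blast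
    have van: "?f t z = 0" if "t \<in> K - {i}" for t
    proof -
      have "s t \<in> P t" using that K by (intro s) auto
      then show ?thesis
        using zK[OF that] class_product_eq_0_iff by blast
    qed
    have nz: "?f i z \<noteq> 0"
    proof
      assume fi: "?f i z = 0"
      show False
      proof (rule one_in_class[OF z(1) h False])
        show "\<exists>j\<in>P t. lin_form (\<alpha> j) z = 0" if t: "t \<in> {1..n} - {k}" for t
        proof (cases "t \<in> K")
          case True
          then show ?thesis
            using van fi class_product_eq_0_iff by blast
        next
          case False
          then show ?thesis using t zR insert.prems(2)[of t] by blast
        qed
      qed (use z in auto)
    qed
    have sum: "?f (n + 1) z = C x i * ?f i z" if x: "x \<in> {h, h'}" for x
    proof -
      have "?f (n + 1) z = (\<Sum>t\<in>K. C x t * ?f t z)"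
        using x h z(2) by (intro C) auto
      also have "\<dots> = C x i * ?f i z + (\<Sum>t\<in>K - {i}. C x t * ?f t z)"
        by (rule sum.remove[OF insert.hyps(1) i])
      also have "(\<Sum>t\<in>K - {i}. C x t * ?f t z) = 0"
        using van by (intro sum.neutral) simp
      finally show ?thesis by simp
    qed
    have "C h i * ?f i z = C h' i * ?f i z"
      using sum[of h] sum[of h'] h by simp
    then show ?thesis using nz by simp
  qed simp
  define h0 where "h0 = s k"
  have h0: "h0 \<in> P k" using s k by (simp add: h0_def)
  define g where "g = (\<lambda>z. ?f (n + 1) z - (\<Sum>i\<in>K. C h0 i * ?f i z))"
  define U where "U = {z. \<forall>i\<in>?R. lin_form (\<alpha> (r i)) z = 0}"
  have hom: "homogeneous m (?f i)" if "i \<in> {1..n+1}" for i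
    using homogeneous_prod_lin_form[of "P i" \<alpha>] card_class[OF that]
    by (simp add: class_product_def[abs_def])
  have "\<exists>c. \<forall>z\<in>U. g z = c * (\<Prod>h\<in>P k. lin_form (\<alpha> h) z)"
  proof (rule divisible_by_lin_forms)
    show "vec.subspace U"
      using subspace_common_kernel[of "\<alpha> ` r ` ?R"] by (simp add: U_def)
    show "homogeneous (card (P k)) g"
      unfolding g_def using hom K k card_class
      by (auto intro!: homogeneous_diff_sum[OF insert.hyps(1)])
    show "g z = 0" if "h \<in> P k" "z \<in> U" "lin_form (\<alpha> h) z = 0" for h z
    proof -
      have "?f (n + 1) z = (\<Sum>i\<in>K. C h i * ?f i z)"
        using that by (intro C) (auto simp: U_def)
      also have "\<dots> = (\<Sum>i\<in>K. C h0 i * ?f i z)"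
        using C_eq[OF that(1) h0] by (intro sum.cong) auto
      finally show ?thesis by (simp add: g_def)
    qed
    show "\<exists>z\<in>U. lin_form (\<alpha> h) z = 0 \<and> lin_form (\<alpha> h') z \<noteq> 0"
      if h: "h \<in> P k" "h' \<in> P k" "h \<noteq> h'" for h h'
    proof -
      let ?X = "r ` ?R \<union> {h} \<union> s ` K"
      have "card ?X \<le> card (r ` ?R) + card {h} + card (s ` K)"
        by (intro order_trans[OF card_Un_le] add_right_mono card_Un_le)
      also have "\<dots> \<le> card ?R + 1 + card K"
        using insert.hyps(1) by (intro add_mono card_image_le) auto
      also have "\<dots> = n" using cardR by simp
      finally obtain z where z: "z \<noteq> 0" "\<And>j. j \<in> ?X \<Longrightarrow> lin_form (\<alpha> j) z = 0"
        by (rule exists_common_zero_of_few) blast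
      have "lin_form (\<alpha> h') z \<noteq> 0"
      proof
        assume h': "lin_form (\<alpha> h') z = 0"
        show False
        proof (rule one_in_class[OF z(1) h _ h'])
          show "\<exists>j\<in>P t. lin_form (\<alpha> j) z = 0" if t: "t \<in> {1..n} - {k}" for t
          proof (cases "t \<in> K")
            case True
            then have "s t \<in> P t" using K by (intro s) auto
            then show ?thesis using z(2) True by blast
          next
            case False
            then show ?thesis using t z(2) insert.prems(2)[of t] by blast
          qed
        qed (use z in auto)
      qed
      moreover have "z \<in> U" using z(2) by (auto simp: U_def)
      ultimately show ?thesis using z(2) by blast
    qed
  qed simp
  then obtain c where c: "\<And>z. z \<in> U \<Longrightarrow> g z = c * ?f k z"
    by (auto simp: class_product_def)
  have "?f (n + 1) z = (\<Sum>i\<in>insert k K. (if i = k then c else C h0 i) * ?f i z)"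
    if "\<forall>i\<in>?R. lin_form (\<alpha> (r i)) z = 0" for z
  proof -
    have "(\<Sum>i\<in>insert k K. (if i = k then c else C h0 i) * ?f i z) =
        c * ?f k z + (\<Sum>i\<in>K. (if i = k then c else C h0 i) * ?f i z)"
      using insert.hyps by simp
    also have "(\<Sum>i\<in>K. (if i = k then c else C h0 i) * ?f i z) = (\<Sum>i\<in>K. C h0 i * ?f i z)"
      using insert.hyps by (intro sum.cong) auto
    also have "c * ?f k z + \<dots> = ?f (n + 1) z"
      using c[of z] that by (simp add: U_def g_def algebra_simps)
    finally show ?thesis by simp
  qed
  then show ?case by (intro exI[of _ "\<lambda>i. if i = k then c else C h0 i"]) blast
qed

text \<open>
  For \<open>K = {1..n}\<close> the slice is the whole space.  If the coefficient of class \<open>q\<close> were zero, the last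
  product would vanish on the common zeros of one form from each of the other classes among the first
  \<open>n\<close>.  These fill a projective line at least, so some form of the last class would vanish on all of
  it, although \<open>n\<close> forms of different classes have only one common zero.
\<close>

lemma class_products_dependent:
  "\<exists>a. (\<forall>i\<in>{1..n+1}. a i \<noteq> 0) \<and> (\<forall>z. (\<Sum>i=1..n+1. a i * class_product i z) = 0)"
proof -
  let ?f = class_product
  obtain s where s: "\<And>i. i \<in> {1..n+1} \<Longrightarrow> s i \<in> P i"
    by (rule exists_representatives) blast
  obtain c where c: "\<And>z. ?f (n + 1) z = (\<Sum>i\<in>{1..n}. c i * ?f i z)"
    using last_product_in_span_on_slice[of "{1..n}" s] by auto
  have "c q \<noteq> 0" if q: "q \<in> {1..n}" for q
  proof
    assume cq: "c q = 0"
    let ?R = "{1..n} - {q}"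
    define U where "U = {z. \<forall>i\<in>?R. lin_form (\<alpha> (s i)) z = 0}"
    have cardR: "card ?R = n - 1" "n \<ge> 1" using q by (auto simp: card_Diff_singleton)
    have "\<exists>z\<in>U. lin_form (\<alpha> w) z \<noteq> 0" if w: "w \<in> P (n + 1)" for w
    proof (rule ccontr)
      assume "\<not> (\<exists>z\<in>U. lin_form (\<alpha> w) z \<noteq> 0)"
      then have w0: "\<And>z. z \<in> U \<Longrightarrow> lin_form (\<alpha> w) z = 0" by auto
      have "card (s ` ?R) \<le> n"
        using card_image_le[of ?R s] cardR by simp
      then obtain x where x: "x \<noteq> 0" "\<And>j. j \<in> s ` ?R \<Longrightarrow> lin_form (\<alpha> j) x = 0"
        by (rule exists_common_zero_of_few) blast
      then have xU: "x \<in> U" by (simp add: U_def)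
      \<comment> \<open>The coordinate form of \<open>k\<close> is nonzero at \<open>x\<close>, so a common zero \<open>y\<close> on its hyperplane
        is a different point.\<close>
      obtain k where k: "x $ k \<noteq> 0" using x(1) by (auto simp: vec_eq_iff)
      let ?A = "insert (axis k 1) (\<alpha> ` s ` ?R)"
      have "card ?A \<le> Suc (card (\<alpha> ` s ` ?R))" by (simp add: card_insert_if)
      also have "\<dots> \<le> Suc (card ?R)"
        using card_image_le[of ?R s] card_image_le[of "s ` ?R" \<alpha>] by simp
      also have "\<dots> < CARD('m)" using cardR card_coordinates by simp
      finally obtain y where y: "y \<noteq> 0" "\<forall>a\<in>?A. lin_form a y = 0"
        using exists_nonzero_solution[of ?A] by auto
      then have yU: "y \<in> U" by (simp add: U_def)
      have yk: "y $ k = 0" using y(2) by (simp add: lin_form_axis)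
      have "x \<in> vec.span {y}"
      proof (rule unique_point[of q y "s(n + 1 := w)" x])
        fix i assume "i \<in> {1..n+1} - {q}"
        then show "(s(n + 1 := w)) i \<in> P i \<and> lin_form (\<alpha> ((s(n + 1 := w)) i)) y = 0 \<and>
            lin_form (\<alpha> ((s(n + 1 := w)) i)) x = 0"
          using s[of i] w w0 xU yU by (auto simp: U_def)
      qed (use q y in auto)
      then show False using k yk by (auto simp: vec.span_singleton)
    qed
    moreover have "vec.subspace U"
      using subspace_common_kernel[of "\<alpha> ` s ` ?R"] by (simp add: U_def)
    ultimately obtain z where z: "z \<in> U" "\<forall>b\<in>\<alpha> ` P (n + 1). lin_form b z \<noteq> 0"
      using exists_common_nonzero[of "\<alpha> ` P (n + 1)" U] by auto
    have "c i * ?f i z = 0" if "i \<in> {1..n}" for i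
      using that cq z(1) s[of i] by (cases "i = q") (auto simp: U_def class_product_eq_0_iff)
    then have "?f (n + 1) z = 0" unfolding c by (intro sum.neutral) blast
    then show False using z(2) by (auto simp: class_product_eq_0_iff)
  qed
  moreover have "(\<Sum>i=1..n+1. (if i = n + 1 then - 1 else c i) * ?f i z) = 0" for z
  proof -
    have "(\<Sum>i=1..n+1. (if i = n + 1 then - 1 else c i) * ?f i z) =
        (\<Sum>i=1..n. (if i = n + 1 then - 1 else c i) * ?f i z) - ?f (n + 1) z"
      by simp
    also have "(\<Sum>i=1..n. (if i = n + 1 then - 1 else c i) * ?f i z) = (\<Sum>i=1..n. c i * ?f i z)"
      by (intro sum.cong) auto
    finally show ?thesis using c[of z] by simp
  qed
  ultimately show ?thesis
    by (intro exI[of _ "\<lambda>i. if i = n + 1 then - 1 else c i"]) auto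
qed

end

section \<open>Products of vectors in the exterior algebra\<close>

definition ext_vec :: "complex ^ 'l::{finite,linorder} \<Rightarrow> complex ^ ('l set)" where
  "ext_vec v = (\<Sum>i\<in>UNIV. v $ i *s ext_gen i)"

definition ext_prod :: "(complex ^ 'l::{finite,linorder}) list \<Rightarrow> complex ^ ('l set)" where
  "ext_prod vs = foldr wedge (map ext_vec vs) (axis {} 1)"

lemma ext_prod_simps [simp]:
  "ext_prod [] = axis {} 1"
  "ext_prod (v # vs) = wedge (ext_vec v) (ext_prod vs)"
  by (simp_all add: ext_prod_def)

lemma wedge_zero [simp]: "wedge 0 a = 0" "wedge a 0 = 0"
  by (simp_all add: vec_eq_iff wedge_def)

lemma wedge_minus_right: "wedge a (- b) = - wedge a b"
  by (simp add: vec_eq_iff wedge_def sum_negf)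

lemma wedge_sum_left: "wedge (sum f A) b = (\<Sum>x\<in>A. wedge (f x) b)"
  by (induction A rule: infinite_finite_induct) (simp_all add: wedge_add_left)

lemma wedge_sum_right: "wedge b (sum f A) = (\<Sum>x\<in>A. wedge b (f x))"
  by (induction A rule: infinite_finite_induct) (simp_all add: wedge_add_right)

lemma ext_vec_axis: "ext_vec (axis i 1) = ext_gen i"
proof -
  have "ext_vec (axis i 1) = (\<Sum>j\<in>UNIV. if j = i then ext_gen i else 0)"
    unfolding ext_vec_def by (rule sum.cong) (auto simp: axis_def)
  then show ?thesis by simp
qed

lemma ext_vec_add_scale: "ext_vec (c *s u + v) = c *s ext_vec u + ext_vec v"
  by (simp add: ext_vec_def vec_eq_iff sum.distrib sum_component sum_distrib_left algebra_simps)

lemma ext_vec_zero [simp]: "ext_vec 0 = 0"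
  by (simp add: ext_vec_def)

lemma ext_monomial_eq_ext_prod: "ext_monomial xs = ext_prod (map (\<lambda>i. axis i 1) xs)"
  by (simp add: ext_monomial_def ext_prod_def ext_vec_axis comp_def)

lemma wedge_ext_gen_nth:
  "wedge (ext_gen i) a $ S =
     (if i \<in> S then (-1) ^ inversions {i} (S - {i}) * a $ (S - {i}) else 0)"
proof -
  have "wedge (ext_gen i) a $ S =
      (\<Sum>T\<in>Pow S. if T = {i} then (-1) ^ inversions {i} (S - {i}) * a $ (S - {i}) else 0)"
    unfolding wedge_def vec_lambda_beta by (rule sum.cong) (auto simp: ext_gen_def axis_def)
  then show ?thesis by simp
qed

lemma wedge_ext_vec_nth:
  "wedge (ext_vec v) a $ S = (\<Sum>i\<in>S. v $ i * wedge (ext_gen i) a $ S)"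
proof -
  have "wedge (ext_vec v) a $ S = (\<Sum>i\<in>UNIV. v $ i * wedge (ext_gen i) a $ S)"
    by (simp add: ext_vec_def wedge_sum_left wedge_scale_left sum_component)
  also have "\<dots> = (\<Sum>i\<in>S. v $ i * wedge (ext_gen i) a $ S)"
    by (intro sum.mono_neutral_right) (auto simp: wedge_ext_gen_nth)
  finally show ?thesis .
qed

lemma ext_vec_anticommute: "wedge (ext_vec u) (ext_vec v) = - wedge (ext_vec v) (ext_vec u)"
proof -
  have expand: "wedge (ext_vec u) (ext_vec v) =
      (\<Sum>i\<in>UNIV. \<Sum>j\<in>UNIV. (u $ i * v $ j) *s wedge (ext_gen i) (ext_gen j))" for u v
    unfolding ext_vec_def wedge_sum_left unfolding wedge_sum_right
    by (simp add: wedge_scale_left wedge_scale_right vector_smult_assoc mult.commute)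
  have "wedge (ext_vec u) (ext_vec v) =
      (\<Sum>j\<in>UNIV. \<Sum>i\<in>UNIV. (u $ i * v $ j) *s wedge (ext_gen i) (ext_gen j))"
    unfolding expand by (rule sum.swap)
  also have "\<dots> = (\<Sum>j\<in>UNIV. \<Sum>i\<in>UNIV. - ((v $ j * u $ i) *s wedge (ext_gen j) (ext_gen i)))"
    by (intro sum.cong refl, subst ext_gen_anticommute) (simp add: mult.commute vec_eq_iff)
  also have "\<dots> = - wedge (ext_vec v) (ext_vec u)"
    unfolding expand by (simp add: sum_negf)
  finally show ?thesis .
qed

lemma ext_vec_square: "wedge (ext_vec v) (ext_vec v) = 0"
  using ext_vec_anticommute[of v v] by (simp add: vec_eq_iff)

lemma wedge_ext_vec_left_commute:
  "wedge (ext_vec u) (wedge (ext_vec v) a) = - wedge (ext_vec v) (wedge (ext_vec u) a)"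
  using ext_vec_anticommute[of u v]
  by (simp add: wedge_assoc[symmetric]) (simp add: vec_eq_iff wedge_def sum_negf)

lemma wedge_member_ext_prod:
  assumes "u \<in> set vs"
  shows "wedge (ext_vec u) (ext_prod vs) = 0"
  using assms
proof (induction vs)
  case (Cons v vs)
  show ?case
  proof (cases "u = v")
    case True
    then show ?thesis by (simp add: wedge_assoc[symmetric] ext_vec_square)
  next
    case False
    then show ?thesis
      using Cons by (simp add: wedge_ext_vec_left_commute[of u])
  qed
qed simp

lemma ext_prod_not_distinct: "\<not> distinct vs \<Longrightarrow> ext_prod vs = 0"
  by (induction vs) (auto simp: wedge_member_ext_prod)

lemma ext_prod_linear:
  "ext_prod (us @ (c *s a + b) # vs) = c *s ext_prod (us @ a # vs) + ext_prod (us @ b # vs)"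
  by (induction us)
    (simp_all add: ext_vec_add_scale wedge_add_left wedge_scale_left wedge_add_right wedge_scale_right)

lemma ext_prod_zero_factor: "ext_prod (us @ 0 # vs) = 0"
  by (induction us) simp_all

lemma ext_prod_in_span:
  assumes "a \<in> vec.span (set us \<union> set vs)"
  shows "ext_prod (us @ a # vs) = 0"
  using assms
proof (induction rule: vec.span_induct_alt)
  case base
  then show ?case by (rule ext_prod_zero_factor)
next
  case (step c x y)
  then have "\<not> distinct (us @ x # vs)" by auto
  then show ?case
    using step by (simp add: ext_prod_linear ext_prod_not_distinct del: distinct_append)
qed

lemma ext_prod_eq_0_of_small_span:
  assumes "set vs \<subseteq> vec.span B" "finite B" "card B < length vs"
  shows "ext_prod vs = 0"
proof (cases "distinct vs")
  case True
  have "\<not> vec.independent (set vs)"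
  proof
    assume "vec.independent (set vs)"
    then have "card (set vs) \<le> card B"
      using vec.independent_span_bound[OF assms(2) _ assms(1)] by blast
    then show False using True assms(3) distinct_card by fastforce
  qed
  then obtain a where a: "a \<in> set vs" "a \<in> vec.span (set vs - {a})"
    by (auto simp: vec.dependent_def)
  then obtain xs ys where vs: "vs = xs @ a # ys" by (meson split_list)
  then have "set vs - {a} = set xs \<union> set ys" using True by auto
  then show ?thesis using ext_prod_in_span a(2) vs by metis
qed (simp add: ext_prod_not_distinct)

lemma ext_prod_nth_card:
  assumes "card T \<noteq> length vs"
  shows "ext_prod vs $ T = 0"
  using assms
proof (induction vs arbitrary: T)
  case Nil
  then show ?case by (auto simp: axis_def)
next
  case (Cons v vs)
  have "ext_prod vs $ (T - {i}) = 0" if "i \<in> T" for i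
    using Cons.prems that card_Suc_Diff1[OF finite that] by (intro Cons.IH) auto
  then show ?case by (simp add: wedge_ext_vec_nth wedge_ext_gen_nth)
qed

lemma ext_prod_nth_cong:
  assumes "length us = length vs" "U \<subseteq> T"
    "\<And>k i. k < length vs \<Longrightarrow> i \<in> T \<Longrightarrow> us ! k $ i = vs ! k $ i"
  shows "ext_prod us $ U = ext_prod vs $ U"
  using assms
proof (induction us vs arbitrary: U rule: list_induct2)
  case (Cons u us v vs)
  have "us ! k $ i = vs ! k $ i" if "k < length vs" "i \<in> T" for k i
    using Cons.prems(2)[of "Suc k" i] that by simp
  then have IH: "ext_prod us $ (U - {i}) = ext_prod vs $ (U - {i})" for i
    using Cons.prems(1) by (intro Cons.IH) auto
  have "u $ i = v $ i" if "i \<in> U" for i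
    using Cons.prems(2)[of 0 i] Cons.prems(1) that by auto
  then show ?case
    by (simp add: wedge_ext_vec_nth wedge_ext_gen_nth IH)
qed simp

text \<open>
  On subsets of \<open>T\<close> the product cannot be distinguished from the monomial of \<open>T\<close>.
\<close>

lemma ext_prod_nth_dual_family:
  fixes b :: "'l::{finite,linorder} \<Rightarrow> (complex, 'l) vec"
  assumes "\<And>s t. s \<in> T \<Longrightarrow> t \<in> T \<Longrightarrow> b s $ t = (if s = t then 1 else 0)"
  shows "ext_prod (map b (sorted_list_of_set T)) $ T = 1"
proof -
  let ?ts = "sorted_list_of_set T"
  have "ext_prod (map b ?ts) $ T = ext_prod (map (\<lambda>i. axis i 1) ?ts) $ T"
  proof (rule ext_prod_nth_cong)
    fix k i assume k: "k < length (map (\<lambda>i. axis i 1 :: (complex, 'l) vec) ?ts)" and i: "i \<in> T"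
    then have "?ts ! k \<in> T" using nth_mem[of k ?ts] by simp
    then show "map b ?ts ! k $ i = map (\<lambda>i. axis i 1) ?ts ! k $ i"
      using k i assms by (simp add: axis_def)
  qed auto
  also have "\<dots> = axis T 1 $ T"
    by (simp add: ext_monomial_eq_ext_prod[symmetric] ext_monomial_sorted)
  finally show ?thesis by simp
qed

text \<open>
  Restricted to \<open>T\<close>, the factors lie in a space of dimension less than their number.
\<close>

lemma ext_prod_nth_equal_coordinates:
  fixes vs :: "(complex, 'l::{finite,linorder}) vec list"
  assumes "s \<in> T" "t \<in> T" "s \<noteq> t" "\<And>v. v \<in> set vs \<Longrightarrow> v $ s = v $ t" "card T = length vs"
  shows "ext_prod vs $ T = 0"
proof -
  let ?B = "insert (axis s 1 + axis t 1) ((\<lambda>i. axis i 1) ` (T - {s, t})) :: (complex, 'l) vec set"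
  define p where "p = (\<lambda>v. \<chi> i. if i \<in> T then v $ i else (0 :: complex))"
  have "ext_prod vs $ T = ext_prod (map p vs) $ T"
    by (rule ext_prod_nth_cong[of _ _ T T]) (auto simp: p_def)
  also have "ext_prod (map p vs) = 0"
  proof (rule ext_prod_eq_0_of_small_span[where B = ?B])
    have "p v \<in> vec.span ?B" if v: "v \<in> set vs" for v
    proof -
      have pv: "p v = v $ s *s (axis s 1 + axis t 1) + (\<Sum>i\<in>T - {s, t}. v $ i *s axis i 1)"
      proof (subst vec_eq_iff, intro allI)
        fix k
        have "(\<Sum>i\<in>T - {s, t}. v $ i *s axis i 1) $ k = (\<Sum>i\<in>T - {s, t}. if i = k then v $ k else 0)"
          unfolding sum_component by (intro sum.cong) (auto simp: axis_def)
        then show "p v $ k = (v $ s *s (axis s 1 + axis t 1) + (\<Sum>i\<in>T - {s, t}. v $ i *s axis i 1)) $ k"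
          using assms(1-3) assms(4)[OF v] by (auto simp: p_def axis_def)
      qed
      have "v $ s *s (axis s 1 + axis t 1) \<in> vec.span ?B"
        by (intro vec.span_scale vec.span_base) simp
      moreover have "(\<Sum>i\<in>T - {s, t}. v $ i *s axis i 1) \<in> vec.span ?B"
        by (intro vec.span_sum vec.span_scale vec.span_base) simp
      ultimately show ?thesis unfolding pv by (rule vec.span_add)
    qed
    then show "set (map p vs) \<subseteq> vec.span ?B" by auto
    have "card ?B \<le> Suc (card ((\<lambda>i. axis i 1 :: (complex, 'l) vec) ` (T - {s, t})))"
      by (simp add: card_insert_if)
    also have "\<dots> \<le> Suc (card (T - {s, t}))"
      by (simp add: card_image_le)
    also have "card (T - {s, t}) < card (T - {s})"
      using assms(1-3) by (intro psubset_card_mono) auto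
    then have "Suc (card (T - {s, t})) < card T"
      using card_Suc_Diff1[OF finite assms(1)] by linarith
    finally show "card ?B < length (map p vs)" using assms(5) by simp
  qed simp
  finally show ?thesis by simp
qed

lemma ext_prod_restrict_eq_0:
  assumes "\<And>i. i \<in> S \<Longrightarrow> u $ i = v $ i" "wedge (ext_vec v) a = 0"
  shows "wedge (ext_vec u) a $ S = 0"
proof -
  have "wedge (ext_vec u) a $ S = wedge (ext_vec v) a $ S"
    unfolding wedge_ext_vec_nth using assms(1) by (intro sum.cong) auto
  then show ?thesis using assms(2) by simp
qed

lemma ext_monomial_nth:
  assumes "T \<noteq> set xs"
  shows "ext_monomial xs $ T = 0"
  using assms
proof (induction xs arbitrary: T)
  case Nil
  then show ?case by (simp add: ext_monomial_def axis_def)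
next
  case (Cons x xs)
  have "ext_monomial xs $ (T - {x}) = 0" if "x \<in> T" 
  proof (cases "x \<in> set xs")
    case False
    then show ?thesis using Cons.prems that by (intro Cons.IH) auto
  next
    case True
    then show ?thesis by (intro Cons.IH) auto
  qed
  then show ?case by (simp add: ext_monomial_def wedge_ext_gen_nth)
qed

lemma wedge_ext_gen_ext_monomial_member:
  "i \<in> set xs \<Longrightarrow> wedge (ext_gen i) (ext_monomial xs) = 0"
  unfolding ext_monomial_eq_ext_prod ext_vec_axis[symmetric]
  by (rule wedge_member_ext_prod) auto

lemma wedge_ext_gen_ext_monomial_move:
  "wedge (ext_gen i) (ext_monomial (as @ bs)) = (-1) ^ length as *s ext_monomial (as @ i # bs)"
proof (induction as)
  case (Cons a as)
  have "wedge (ext_gen i) (ext_monomial ((a # as) @ bs)) =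
      - wedge (ext_gen a) (wedge (ext_gen i) (ext_monomial (as @ bs)))"
    using wedge_ext_vec_left_commute[of "axis i 1" "axis a 1" "ext_monomial (as @ bs)"]
    by (simp add: ext_monomial_def ext_vec_axis)
  also have "\<dots> = (-1) ^ length (a # as) *s ext_monomial ((a # as) @ i # bs)"
    unfolding Cons by (simp add: wedge_scale_right ext_monomial_def vec_eq_iff)
  finally show ?case .
qed (simp add: ext_monomial_def)

text \<open>
  Only the term that omits \<open>i\<close> survives.  Multiplying by a generator turns the alternating signs of the
  boundary into a value that is the same for all elements of \<open>xs\<close>, in whatever order they are listed.
\<close>

lemma wedge_ext_gen_ext_boundary:
  assumes "distinct xs" "i \<in> set xs"
  shows "wedge (ext_gen i) (ext_boundary xs) = - ext_monomial xs"
proof -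
  obtain k where k: "k < length xs" "xs ! k = i"
    using assms(2) by (auto simp: in_set_conv_nth)
  let ?m = "\<lambda>j. ext_monomial (take j xs @ drop (Suc j) xs)"
  have "wedge (ext_gen i) (ext_boundary xs) =
      (\<Sum>j<length xs. (-1) ^ Suc j *s wedge (ext_gen i) (?m j))"
    by (simp add: ext_boundary_def wedge_sum_right wedge_scale_right wedge_minus_right)
  also have "\<dots> = (\<Sum>j<length xs. if j = k then - ext_monomial xs else 0)"
  proof (intro sum.cong refl)
    fix j assume "j \<in> {..<length xs}"
    then have j: "j < length xs" by simp
    show "(-1) ^ Suc j *s wedge (ext_gen i) (?m j) = (if j = k then - ext_monomial xs else 0)"
    proof (cases "j = k")
      case True
      have "take j xs @ i # drop (Suc j) xs = xs"
        using k True id_take_nth_drop[OF j] by simp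
      moreover have "(-1 :: complex) ^ Suc j * (-1) ^ j = - 1"
        by (simp add: power_add[symmetric] mult_2[symmetric])
      ultimately show ?thesis
        using True j by (simp add: wedge_ext_gen_ext_monomial_move vector_smult_assoc)
    next
      case False
      have "i \<in> set (take j xs @ drop (Suc j) xs)"
      proof (cases "k < j")
        case True
        then have "take j xs ! k = i" "k < length (take j xs)" using k j by auto
        then show ?thesis by (metis UnI1 nth_mem set_append)
      next
        case False
        then have "drop (Suc j) xs ! (k - Suc j) = i" "k - Suc j < length (drop (Suc j) xs)"
          using k \<open>j \<noteq> k\<close> by auto
        then show ?thesis by (metis UnI2 nth_mem set_append)
      qed
      then show ?thesis using False by (simp add: wedge_ext_gen_ext_monomial_member)
    qed
  qed
  also have "\<dots> = - ext_monomial xs" using k(1) by simp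
  finally show ?thesis .
qed

lemma ext_boundary_nth_eq_0:
  assumes "distinct xs" "\<not> (T \<subseteq> set xs \<and> Suc (card T) = length xs)"
  shows "ext_boundary xs $ T = 0"
proof -
  have "ext_monomial (take j xs @ drop (Suc j) xs) $ T = 0" if j: "j < length xs" for j
  proof (rule ext_monomial_nth, rule notI)
    assume T: "T = set (take j xs @ drop (Suc j) xs)"
    have "xs = take j xs @ xs ! j # drop (Suc j) xs"
      by (rule id_take_nth_drop[OF j])
    then have "distinct (take j xs @ xs ! j # drop (Suc j) xs)" using assms(1) by simp
    then have "distinct (take j xs @ drop (Suc j) xs)" by simp
    then have "card T = length (take j xs @ drop (Suc j) xs)"
      unfolding T by (rule distinct_card)
    then have "Suc (card T) = length xs" using j by simp
    moreover have "T \<subseteq> set xs"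
      unfolding T by (auto dest: in_set_takeD in_set_dropD)
    ultimately show False using assms(2) by blast
  qed
  then show ?thesis
    by (simp add: ext_boundary_def sum_component)
qed

lemma wedge_nth_lowest:
  assumes "\<And>U. card U < card T \<Longrightarrow> w $ U = 0"
  shows "wedge a w $ T = a $ {} * w $ T" "wedge w a $ T = w $ T * a $ {}"
proof -
  have small: "w $ (T - U) = 0" if "U \<subseteq> T" "U \<noteq> {}" for U
    using that by (intro assms psubset_card_mono) auto
  have "wedge a w $ T = (\<Sum>U\<in>Pow T. if U = {} then a $ {} * w $ T else 0)"
    unfolding wedge_def vec_lambda_beta using small by (intro sum.cong) auto
  then show "wedge a w $ T = a $ {} * w $ T" by simp
  have small': "w $ U = 0" if "U \<subseteq> T" "U \<noteq> T" for U
    using that by (intro assms psubset_card_mono) auto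
  have "wedge w a $ T = (\<Sum>U\<in>Pow T. if U = T then w $ T * a $ {} else 0)"
    unfolding wedge_def vec_lambda_beta using small' by (intro sum.cong) auto
  then show "wedge w a $ T = w $ T * a $ {}" by simp
qed

section \<open>The Orlik-Solomon ideal in degree \<open>n\<close>\<close>

lemma ideal_os_ideal: "ideal (os_ideal H) ext_alg"
  unfolding os_ideal_def by (rule ring.genideal_ideal[OF ring_ext_alg]) (simp add: ext_alg_def)

lemma os_ideal_scale: "w \<in> os_ideal H \<Longrightarrow> c *s w \<in> os_ideal H"
  using ideal.I_l_closed[OF ideal_os_ideal, of w H "c *s axis {} 1"]
  by (simp add: ext_alg_def wedge_scale_left wedge_one_left)

lemma os_ideal_zero: "0 \<in> os_ideal H"
  using additive_subgroup.zero_closed[OF ideal.axioms(1)[OF ideal_os_ideal], of H]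
  by (simp add: ext_alg_def)

lemma os_ideal_sum: "(\<And>x. x \<in> A \<Longrightarrow> f x \<in> os_ideal H) \<Longrightarrow> sum f A \<in> os_ideal H"
proof (induction A rule: infinite_finite_induct)
  case (insert x A)
  then show ?case
    using additive_subgroup.a_closed[OF ideal.axioms(1)[OF ideal_os_ideal], of "f x" H "sum f A"]
    by (simp add: ext_alg_def)
qed (simp_all add: os_ideal_zero)

lemma os_class_product:
  "foldr (mult (os_alg H)) (map (os_class H) vs) \<one>\<^bsub>os_alg H\<^esub> =
     os_ideal H +>\<^bsub>ext_alg\<^esub> ext_prod vs"
proof (induction vs)
  case Nil
  then show ?case by (simp add: os_alg_def FactRing_def ext_alg_def)
next
  case (Cons v vs)
  have "os_class H v = os_ideal H +>\<^bsub>ext_alg\<^esub> ext_vec v"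
    by (simp add: os_class_def ext_vec_def)
  moreover have "rcoset_mult ext_alg (os_ideal H) (os_ideal H +>\<^bsub>ext_alg\<^esub> ext_vec v)
      (os_ideal H +>\<^bsub>ext_alg\<^esub> ext_prod vs) = os_ideal H +>\<^bsub>ext_alg\<^esub> (ext_vec v \<otimes>\<^bsub>ext_alg\<^esub> ext_prod vs)"
    by (rule ideal.rcoset_mult_add[OF ideal_os_ideal]) (simp_all add: ext_alg_def)
  ultimately show ?case
    using Cons by (simp add: os_alg_def FactRing_def) (simp add: ext_alg_def)
qed

lemma isotropic_iff:
  "isotropic H k V \<longleftrightarrow> vec.subspace V \<and>
     (\<forall>vs. length vs = k \<and> set vs \<subseteq> V \<longrightarrow> ext_prod vs \<in> os_ideal H)"
proof -
  have "os_ideal H +>\<^bsub>ext_alg\<^esub> w = \<zero>\<^bsub>os_alg H\<^esub> \<longleftrightarrow> w \<in> os_ideal H" for w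
  proof -
    have "w \<in> carrier ext_alg" by (simp add: ext_alg_def)
    then show ?thesis
      using ideal.rcos_const_imp_mem[OF ideal_os_ideal, of w H] ring.a_rcos_zero[OF ring_ext_alg ideal_os_ideal, of w H]
      by (auto simp: os_alg_def FactRing_def)
  qed
  then show ?thesis
    by (simp add: isotropic_def os_class_product)
qed

context generic_innc_arrangement
begin

text \<open>
  The last clause says that the coefficients at the \<open>n\<close>-subsets of a circuit are proportional to those of
  its boundary: multiplication by the missing generator absorbs the signs.
\<close>

definition circuit_condition :: "complex ^ ('l set) \<Rightarrow> bool" where
  "circuit_condition w \<longleftrightarrow>
     (\<forall>T. card T < n \<longrightarrow> w $ T = 0) \<and>
     (\<forall>T. card T = n \<longrightarrow> (\<forall>S. circuit S \<longrightarrow> \<not> T \<subseteq> S) \<longrightarrow> w $ T = 0) \<and>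
     (\<forall>S s t. circuit S \<longrightarrow> s \<in> S \<longrightarrow> t \<in> S \<longrightarrow>
        wedge (ext_gen s) w $ S = wedge (ext_gen t) w $ S)"

lemma circuit_conditionI:
  assumes "\<And>T. card T < n \<Longrightarrow> w $ T = 0"
    and "\<And>T. card T = n \<Longrightarrow> (\<And>S. circuit S \<Longrightarrow> \<not> T \<subseteq> S) \<Longrightarrow> w $ T = 0"
    and "\<And>S s t. circuit S \<Longrightarrow> s \<in> S \<Longrightarrow> t \<in> S \<Longrightarrow>
        wedge (ext_gen s) w $ S = wedge (ext_gen t) w $ S"
  shows "circuit_condition w"
  using assms unfolding circuit_condition_def by blast

lemma circuit_conditionD:
  assumes "circuit_condition w"
  shows "card T < n \<Longrightarrow> w $ T = 0"
    and "card T = n \<Longrightarrow> (\<And>S. circuit S \<Longrightarrow> \<not> T \<subseteq> S) \<Longrightarrow> w $ T = 0"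
    and "circuit S \<Longrightarrow> s \<in> S \<Longrightarrow> t \<in> S \<Longrightarrow> wedge (ext_gen s) w $ S = wedge (ext_gen t) w $ S"
proof -
  note * = assms[unfolded circuit_condition_def]
  show "card T < n \<Longrightarrow> w $ T = 0" using conjunct1[OF *] by simp
  show "card T = n \<Longrightarrow> (\<And>S. circuit S \<Longrightarrow> \<not> T \<subseteq> S) \<Longrightarrow> w $ T = 0"
    using conjunct1[OF conjunct2[OF *]] by simp
  show "circuit S \<Longrightarrow> s \<in> S \<Longrightarrow> t \<in> S \<Longrightarrow> wedge (ext_gen s) w $ S = wedge (ext_gen t) w $ S"
    using conjunct2[OF conjunct2[OF *]] by blast
qed

lemma card_circuit_minus:
  assumes "circuit S" "s \<in> S"
  shows "card (S - {s}) = n"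
  using circuit_card[OF assms(1)] assms(2) by simp

text \<open>
  The condition involves only coefficients of degree at most \<open>n\<close>, and a vector that satisfies
  it has none below \<open>n\<close>.  On such a vector multiplication by \<open>a\<close> therefore acts, in these degrees, as multiplication by the constant term of \<open>a\<close>; this lemma
  reduces the ideal property to that observation.
\<close>

lemma circuit_condition_scaled:
  assumes w: "circuit_condition w"
    and u: "\<And>T. card T \<le> n \<Longrightarrow> u $ T = c * w $ T"
  shows "circuit_condition u"
proof (rule circuit_conditionI)
  show "u $ T = 0" if "card T < n" for T
    using that u circuit_conditionD(1)[OF w] by simp
  show "u $ T = 0" if "card T = n" "\<And>S. circuit S \<Longrightarrow> \<not> T \<subseteq> S" for T
    using that u circuit_conditionD(2)[OF w] by simp
  have *: "wedge (ext_gen s) u $ S = c * wedge (ext_gen s) w $ S" if "circuit S" "s \<in> S" for s S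
    using that u[of "S - {s}"] card_circuit_minus[OF that] by (simp add: wedge_ext_gen_nth)
  show "wedge (ext_gen s) u $ S = wedge (ext_gen t) u $ S" if "circuit S" "s \<in> S" "t \<in> S" for S s t
    using that circuit_conditionD(3)[OF w that] by (simp add: *)
qed

lemma ideal_circuit_condition: "ideal {w. circuit_condition w} ext_alg"
proof (rule idealI[OF ring_ext_alg])
  show "subgroup {w. circuit_condition w} (add_monoid ext_alg)"
  proof
    show "\<one>\<^bsub>add_monoid ext_alg\<^esub> \<in> {w. circuit_condition w}"
      by (simp add: ext_alg_def circuit_condition_def)
    fix u w assume "u \<in> {w. circuit_condition w}" "w \<in> {w. circuit_condition w}"
    then have u: "circuit_condition u" and w: "circuit_condition w" by auto
    have "circuit_condition (u + w)"
    proof (rule circuit_conditionI)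
      show "(u + w) $ T = 0" if "card T < n" for T
        using circuit_conditionD(1)[OF u that] circuit_conditionD(1)[OF w that] by simp
      show "(u + w) $ T = 0" if T: "card T = n" "\<And>S. circuit S \<Longrightarrow> \<not> T \<subseteq> S" for T
        using circuit_conditionD(2)[OF u T] circuit_conditionD(2)[OF w T] by simp
      show "wedge (ext_gen s) (u + w) $ S = wedge (ext_gen t) (u + w) $ S"
        if S: "circuit S" "s \<in> S" "t \<in> S" for S s t
        using circuit_conditionD(3)[OF u S] circuit_conditionD(3)[OF w S] by (simp add: wedge_add_right)
    qed
    then show "u \<otimes>\<^bsub>add_monoid ext_alg\<^esub> w \<in> {w. circuit_condition w}"
      by (simp add: ext_alg_def)
  next
    fix w assume w: "w \<in> {w. circuit_condition w}"
    have "\<ominus>\<^bsub>ext_alg\<^esub> w = - w"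
      using abelian_group.minus_equality[OF ring.is_abelian_group[OF ring_ext_alg], of "- w" w]
      by (simp add: ext_alg_def)
    then show "inv\<^bsub>add_monoid ext_alg\<^esub> w \<in> {w. circuit_condition w}"
      using w circuit_condition_scaled[of w "- w" "- 1"] by (simp add: a_inv_def)
  qed (simp add: ext_alg_def)
next
  fix w a assume w: "w \<in> {w. circuit_condition w}"
  then have cw: "circuit_condition w" by simp
  have "wedge a w $ T = a $ {} * w $ T" "wedge w a $ T = a $ {} * w $ T" if T: "card T \<le> n" for T
  proof -
    have "w $ U = 0" if "card U < card T" for U
      using that T by (intro circuit_conditionD(1)[OF cw]) simp
    then show "wedge a w $ T = a $ {} * w $ T" "wedge w a $ T = a $ {} * w $ T"
      by (simp_all add: wedge_nth_lowest)
  qed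
  then have "circuit_condition (wedge a w)" "circuit_condition (wedge w a)"
    using circuit_condition_scaled[OF cw] by blast+
  then show "a \<otimes>\<^bsub>ext_alg\<^esub> w \<in> {w. circuit_condition w}"
    "w \<otimes>\<^bsub>ext_alg\<^esub> a \<in> {w. circuit_condition w}"
    by (simp_all add: ext_alg_def)
qed

lemma circuit_condition_boundary:
  assumes "distinct xs" "circuit (set xs)"
  shows "circuit_condition (ext_boundary xs)"
proof (rule circuit_conditionI)
  have len: "length xs = n + 1"
    using circuit_card[OF assms(2)] distinct_card[OF assms(1)] by simp
  show "ext_boundary xs $ T = 0" if "card T < n" for T
    using that len by (intro ext_boundary_nth_eq_0[OF assms(1)]) auto
  show "ext_boundary xs $ T = 0" if "card T = n" "\<And>S. circuit S \<Longrightarrow> \<not> T \<subseteq> S" for T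
    using that assms by (intro ext_boundary_nth_eq_0) auto
  fix S s t assume S: "circuit S" "s \<in> S" "t \<in> S"
  show "wedge (ext_gen s) (ext_boundary xs) $ S = wedge (ext_gen t) (ext_boundary xs) $ S"
  proof (cases "S = set xs")
    case True
    then show ?thesis using S assms(1) by (simp add: wedge_ext_gen_ext_boundary)
  next
    case False
    have "ext_boundary xs $ (S - {i}) = 0" if i: "i \<in> S" for i
    proof (rule ext_boundary_nth_eq_0[OF assms(1)], rule notI)
      assume "S - {i} \<subseteq> set xs \<and> Suc (card (S - {i})) = length xs"
      then have "S = set xs"
        using circuit_unique[OF S(1) assms(2), of "S - {i}"] card_circuit_minus[OF S(1) i] by blast
      then show False using False by simp
    qed
    then show ?thesis using S by (simp add: wedge_ext_gen_nth)
  qed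
qed

text \<open>
  Any \<open>n\<close> hyperplanes have a common point, so these relations have degree greater than \<open>n\<close>.
\<close>

lemma circuit_condition_monomial:
  assumes "distinct xs" "hyperplane_meet H (set xs) = {}"
  shows "circuit_condition (ext_monomial xs)"
proof -
  have "\<not> card (set xs) \<le> n"
  proof
    assume "card (set xs) \<le> n"
    then obtain z where "z \<noteq> 0" "set xs \<subseteq> vanishing z" by (rule exists_common_zero)
    then show False using assms(2) meet_nonempty_iff by blast
  qed
  then have "ext_monomial xs $ T = 0" if "card T \<le> n" for T
    using that by (intro ext_monomial_nth) auto
  moreover have "circuit_condition 0"
    by (simp add: circuit_condition_def)
  ultimately show ?thesis
    using circuit_condition_scaled[of 0 "ext_monomial xs" 0] by simp
qed

lemma os_ideal_imp_circuit_condition: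
  assumes "w \<in> os_ideal H"
  shows "circuit_condition w"
proof -
  have "os_relations H \<subseteq> {w. circuit_condition w}"
  proof
    fix u assume "u \<in> os_relations H"
    then consider xs where "u = ext_boundary xs" "distinct xs" "hyperplane_meet H (set xs) \<noteq> {}"
        "proj_codim (hyperplane_meet H (set xs)) < length xs"
      | xs where "u = ext_monomial xs" "distinct xs" "hyperplane_meet H (set xs) = {}"
      unfolding os_relations_def by blast
    then show "u \<in> {w. circuit_condition w}"
    proof cases
      case (1 xs)
      then have "circuit (set xs)"
        using nongeneric_iff_circuit[of "set xs"] distinct_card[of xs] by auto
      then show ?thesis using 1 circuit_condition_boundary by simp
    next
      case (2 xs)
      then show ?thesis using circuit_condition_monomial by simp
    qed
  qed
  then have "os_ideal H \<subseteq> {w. circuit_condition w}"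
    unfolding os_ideal_def by (rule ring.genideal_minimal[OF ring_ext_alg ideal_circuit_condition])
  then show ?thesis using assms by auto
qed

lemma circuit_boundary_in_os_ideal:
  assumes "circuit S"
  shows "ext_boundary (sorted_list_of_set S) \<in> os_ideal H"
proof -
  have "ext_boundary (sorted_list_of_set S) \<in> os_relations H"
    unfolding os_relations_def
    using assms nongeneric_iff_circuit[of S]
    by (intro UnI1 CollectI exI[of _ "sorted_list_of_set S"]) auto
  then show ?thesis
    unfolding os_ideal_def using ring.genideal_self[OF ring_ext_alg, of "os_relations H"]
    by (auto simp: ext_alg_def)
qed

text \<open>
  Every \<open>n\<close>-set lies in at most one circuit, so the boundaries of different circuits do not interfere
  and the coefficient of each can be read off from \<open>w\<close>.
\<close>

lemma homogeneous_in_os_ideal: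
  assumes "circuit_condition w" "\<And>T. card T \<noteq> n \<Longrightarrow> w $ T = 0"
  shows "w \<in> os_ideal H"
proof -
  define bd where "bd = (\<lambda>S. ext_boundary (sorted_list_of_set S :: 'l list))"
  define c where "c = (\<lambda>S. - wedge (ext_gen (SOME s. s \<in> S)) w $ S)"
  have bd0: "bd S $ T = 0" if "\<not> (T \<subseteq> S \<and> Suc (card T) = card S)" for S T
    unfolding bd_def using that by (intro ext_boundary_nth_eq_0) auto
  have c: "c S = - wedge (ext_gen s) w $ S" if "circuit S" "s \<in> S" for S s
    using circuit_conditionD(3)[OF assms(1) that(1), of "SOME s. s \<in> S" s] that(2)
    by (simp add: c_def some_in_eq) (metis empty_iff someI)
  have gen: "wedge (ext_gen s) (bd S) $ S = - 1" if "s \<in> S" for S s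
    using that by (simp add: bd_def wedge_ext_gen_ext_boundary ext_monomial_sorted)
  have "w = (\<Sum>S | circuit S. c S *s bd S)"
  proof (subst vec_eq_iff, intro allI)
    fix T
    have sum: "(\<Sum>S | circuit S. c S *s bd S) $ T = (\<Sum>S | circuit S. c S * bd S $ T)"
      by (simp add: sum_component)
    show "w $ T = (\<Sum>S | circuit S. c S *s bd S) $ T"
    proof (cases "card T = n \<and> (\<exists>S. circuit S \<and> T \<subseteq> S)")
      case True
      then obtain S where T: "card T = n" and S: "circuit S" "T \<subseteq> S" by blast
      have "card (S - T) = 1"
        using S T circuit_card by (simp add: card_Diff_subset)
      then obtain s where s: "S - T = {s}" by (rule card_1_singletonE)
      then have sT: "s \<in> S" "S - {s} = T" using S(2) by auto
      have "c S' * bd S' $ T = 0" if "circuit S'" "S' \<noteq> S" for S'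
        using that circuit_unique[OF that(1) S(1) _ S(2) T] bd0 by auto
      then have "(\<Sum>S | circuit S. c S * bd S $ T) = (\<Sum>S'\<in>{S}. c S' * bd S' $ T)"
        using S(1) by (intro sum.mono_neutral_right) auto
      moreover have "c S * bd S $ T = w $ T"
      proof -
        let ?e = "(-1 :: complex) ^ inversions {s} T"
        have "?e * bd S $ T = - 1"
          using gen[OF sT(1)] sT by (simp add: wedge_ext_gen_nth)
        moreover have "c S * bd S $ T = - (?e * bd S $ T) * w $ T"
          using c[OF S(1) sT(1)] sT by (simp add: wedge_ext_gen_nth)
        ultimately show ?thesis by simp
      qed
      ultimately show ?thesis by (simp add: sum)
    next
      case False
      have "w $ T = 0"
        using False assms(2)[of T] circuit_conditionD(2)[OF assms(1), of T] by blast
      moreover have "bd S $ T = 0" if "circuit S" for S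
        using that False circuit_card[OF that] by (intro bd0) auto
      ultimately show ?thesis by (simp add: sum)
    qed
  qed
  moreover have "(\<Sum>S | circuit S. c S *s bd S) \<in> os_ideal H"
    unfolding bd_def by (intro os_ideal_sum os_ideal_scale circuit_boundary_in_os_ideal) simp
  ultimately show ?thesis by simp
qed

end

section \<open>Coordinates on a subspace\<close>

text \<open>
  The coordinates indexed by \<open>T\<close>, as linear functionals, form a basis of the dual of \<open>V\<close>.
\<close>

definition coordinate_basis :: "(complex, 'l::finite) vec set \<Rightarrow> 'l set \<Rightarrow> bool" where
  "coordinate_basis V T \<longleftrightarrow> card T = vec.dim V \<and> (\<forall>v\<in>V. (\<forall>t\<in>T. v $ t = 0) \<longrightarrow> v = 0)"

definition coordinate_projection :: "'l set \<Rightarrow> (complex, 'l::finite) vec \<Rightarrow> (complex, 'l) vec" where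
  "coordinate_projection T v = (\<chi> i. if i \<in> T then v $ i else 0)"

lemma linear_coordinate_projection: "Vector_Spaces.linear (*s) (*s) (coordinate_projection T)"
  by unfold_locales (auto simp: coordinate_projection_def vec_eq_iff algebra_simps)

lemma coordinate_projection_in_span:
  "coordinate_projection T v \<in> vec.span ((\<lambda>t. axis t 1) ` T)"
proof -
  have "coordinate_projection T v = (\<Sum>t\<in>T. v $ t *s axis t 1)"
  proof (subst vec_eq_iff, intro allI)
    fix k
    have "(\<Sum>t\<in>T. v $ t *s axis t 1) $ k = (\<Sum>t\<in>T. if t = k then v $ k else 0)"
      unfolding sum_component by (intro sum.cong) (auto simp: axis_def)
    then show "coordinate_projection T v $ k = (\<Sum>t\<in>T. v $ t *s axis t 1) $ k"
      by (simp add: coordinate_projection_def)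
  qed
  also have "\<dots> \<in> vec.span ((\<lambda>t. axis t 1) ` T)"
    by (intro vec.span_sum vec.span_scale vec.span_base) simp
  finally show ?thesis .
qed

lemma dim_coordinate_projection:
  fixes V :: "(complex, 'l::finite) vec set"
  assumes "vec.subspace V" "\<And>v. v \<in> V \<Longrightarrow> (\<And>t. t \<in> T \<Longrightarrow> v $ t = 0) \<Longrightarrow> v = 0"
  shows "vec.dim (coordinate_projection T ` V) = vec.dim V"
proof (rule vec.dim_image_eq[OF linear_coordinate_projection])
  have "inj_on (coordinate_projection T) V"
  proof (rule inj_onI)
    fix u v assume uv: "u \<in> V" "v \<in> V" "coordinate_projection T u = coordinate_projection T v"
    have "u - v = 0"
    proof (rule assms(2))
      show "u - v \<in> V" using uv assms(1) by (simp add: vec.subspace_diff)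
      show "(u - v) $ t = 0" if "t \<in> T" for t
        using uv(3) that by (auto simp: coordinate_projection_def vec_eq_iff split: if_splits)
    qed
    then show "u = v" by simp
  qed
  then show "inj_on (coordinate_projection T) (vec.span V)"
    unfolding vec.span_eq_iff[THEN iffD2, OF assms(1)] .
qed

lemma dim_le_card_of_detecting:
  fixes V :: "(complex, 'l::finite) vec set"
  assumes "vec.subspace V" "\<And>v. v \<in> V \<Longrightarrow> (\<And>t. t \<in> T \<Longrightarrow> v $ t = 0) \<Longrightarrow> v = 0"
  shows "vec.dim V \<le> card T"
proof -
  have "vec.dim (coordinate_projection T ` V) \<le> card ((\<lambda>t. axis t 1 :: (complex, 'l) vec) ` T)"
    by (intro vec.dim_le_card) (auto simp: coordinate_projection_in_span)
  also have "\<dots> \<le> card T" by (intro card_image_le) simp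
  finally show ?thesis using dim_coordinate_projection[OF assms] by simp
qed

text \<open>
  Pass to the kernel of a coordinate that is nonzero on \<open>V\<close>.
\<close>

lemma exists_coordinate_basis:
  fixes V :: "(complex, 'l::finite) vec set"
  assumes "vec.subspace V"
  shows "\<exists>T. coordinate_basis V T"
  using assms
proof (induction "vec.dim V" arbitrary: V rule: less_induct)
  case less
  show ?case
  proof (cases "V \<subseteq> {0}")
    case True
    then have "vec.dim V = 0" by (simp add: vec.dim_eq_0)
    then show ?thesis
      using True by (intro exI[of _ "{}"]) (auto simp: coordinate_basis_def)
  next
    case False
    then obtain v where v: "v \<in> V" "v \<noteq> 0" by auto
    then obtain t where t: "v $ t \<noteq> 0" by (auto simp: vec_eq_iff)
    define W where "W = {u \<in> V. u $ t = 0}"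
    have W: "vec.subspace W"
      using less.prems by (auto simp: W_def vec.subspace_def)
    have "W \<subset> V" using v t by (auto simp: W_def)
    then have "vec.span W \<subset> vec.span V"
      unfolding vec.span_eq_iff[THEN iffD2, OF W] vec.span_eq_iff[THEN iffD2, OF less.prems] .
    then have dim: "vec.dim W < vec.dim V" by (rule vec.dim_psubset)
    then obtain T where T: "coordinate_basis W T"
      using less.hyps W by blast
    have det: "u = 0" if "u \<in> V" "\<And>i. i \<in> insert t T \<Longrightarrow> u $ i = 0" for u
      using that T by (auto simp: coordinate_basis_def W_def)
    then have "vec.dim V \<le> card (insert t T)"
      using dim_le_card_of_detecting[OF less.prems] by blast
    moreover have "card (insert t T) \<le> Suc (card T)" by (simp add: card_insert_if)
    ultimately have "card (insert t T) = vec.dim V"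
      using dim T by (simp add: coordinate_basis_def)
    then have "coordinate_basis V (insert t T)"
      using det unfolding coordinate_basis_def by blast
    then show ?thesis by blast
  qed
qed

lemma coordinate_basis_dual:
  fixes V :: "(complex, 'l::finite) vec set"
  assumes V: "vec.subspace V" and T: "coordinate_basis V T"
  obtains b where "\<And>s. s \<in> T \<Longrightarrow> b s \<in> V"
    "\<And>s t. s \<in> T \<Longrightarrow> t \<in> T \<Longrightarrow> b s $ t = (if s = t then 1 else 0)"
proof -
  let ?p = "coordinate_projection T"
  let ?W = "vec.span ((\<lambda>t. axis t 1 :: (complex, 'l) vec) ` T)"
  have "vec.dim ?W \<le> card ((\<lambda>t. axis t 1 :: (complex, 'l) vec) ` T)"
    by (intro vec.dim_le_card) auto
  also have "\<dots> \<le> card T" by (intro card_image_le) simp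
  also have "\<dots> = vec.dim (?p ` V)"
    using T dim_coordinate_projection[OF V, of T] by (auto simp: coordinate_basis_def)
  finally have "?p ` V = ?W"
    by (intro vec.subspace_dim_equal vec.linear_subspace_image[OF linear_coordinate_projection] V)
      (auto simp: coordinate_projection_in_span)
  then have "\<forall>s\<in>T. \<exists>v\<in>V. axis s 1 = ?p v"
    using vec.span_base[of _ "(\<lambda>t. axis t 1 :: (complex, 'l) vec) ` T"] by blast
  then obtain b where b: "\<And>s. s \<in> T \<Longrightarrow> b s \<in> V \<and> axis s 1 = ?p (b s)"
    by (metis (no_types))
  have "b s $ t = (if s = t then 1 else 0)" if "s \<in> T" "t \<in> T" for s t
  proof -
    have "b s $ t = ?p (b s) $ t" using that by (simp add: coordinate_projection_def)
    also have "\<dots> = axis s 1 $ t" using b that by simp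
    finally show ?thesis by (simp add: axis_def)
  qed
  then show ?thesis using that b by blast
qed

lemma coordinate_basis_expand:
  assumes "vec.subspace V" "coordinate_basis V T" "\<And>s. s \<in> T \<Longrightarrow> b s \<in> V"
    "\<And>s t. s \<in> T \<Longrightarrow> t \<in> T \<Longrightarrow> b s $ t = (if s = t then 1 else 0)" "v \<in> V"
  shows "v = (\<Sum>s\<in>T. v $ s *s b s)"
proof -
  have "v - (\<Sum>s\<in>T. v $ s *s b s) = 0"
  proof -
    have "v - (\<Sum>s\<in>T. v $ s *s b s) \<in> V"
      using assms by (intro vec.subspace_diff vec.subspace_sum vec.subspace_scale) auto
    moreover have "(v - (\<Sum>s\<in>T. v $ s *s b s)) $ t = 0" if "t \<in> T" for t
    proof -
      have "(\<Sum>s\<in>T. v $ s *s b s) $ t = (\<Sum>s\<in>T. if s = t then v $ t else 0)"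
        unfolding sum_component using assms(4) that by (intro sum.cong) auto
      then show ?thesis using that by simp
    qed
    ultimately show ?thesis using assms(2) by (auto simp: coordinate_basis_def)
  qed
  then show ?thesis by simp
qed

text \<open>
  The vector \<open>w\<close> spans the line of \<open>V\<close> on which the coordinates of \<open>T - {t}\<close> vanish, so any coordinate
  that is nonzero at \<open>w\<close> can take the place of \<open>t\<close>.
\<close>

lemma coordinate_basis_exchange:
  assumes V: "vec.subspace V" and T: "coordinate_basis V T"
    and w: "w \<in> V" "t \<in> T" "\<And>r. r \<in> T - {t} \<Longrightarrow> w $ r = 0" and j: "w $ j \<noteq> 0"
  shows "coordinate_basis V (insert j (T - {t}))"
proof -
  have wt: "w $ t \<noteq> 0"
  proof
    assume "w $ t = 0"
    then have "\<forall>r\<in>T. w $ r = 0" using w(3) by (metis DiffI singletonD)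
    then have "w = 0" using T w(1) by (simp add: coordinate_basis_def)
    then show False using j by simp
  qed
  have "j \<notin> T - {t}" using w(3) j by blast
  then have "card (insert j (T - {t})) = vec.dim V"
    using T w(2) card_Suc_Diff1[of T t] by (simp add: coordinate_basis_def)
  moreover have "v = 0" if v: "v \<in> V" "\<forall>i\<in>insert j (T - {t}). v $ i = 0" for v
  proof -
    \<comment> \<open>The multiple of \<open>w\<close> is chosen to cancel the coordinate \<open>t\<close>.\<close>
    define u where "u = v - (v $ t / w $ t) *s w"
    have "u \<in> V" using v w(1) V by (simp add: u_def vec.subspace_diff vec.subspace_scale)
    moreover have "u $ r = 0" if "r \<in> T" for r
      using that v(2) w(3)[of r] wt by (cases "r = t") (auto simp: u_def)
    ultimately have "u = 0" using T by (auto simp: coordinate_basis_def)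
    then have v_eq: "v = (v $ t / w $ t) *s w" by (simp add: u_def)
    have "v $ j = (v $ t / w $ t) * w $ j" by (subst v_eq) simp
    then have "v $ t / w $ t = 0" using v(2) j by simp
    then show "v = 0" using v_eq by (metis vec.scale_zero_left)
  qed
  ultimately show ?thesis by (auto simp: coordinate_basis_def)
qed

lemma wedge_ext_prod_eq_0:
  assumes "vec.dim V = n" "v \<in> V" "set vs \<subseteq> V" "length vs = n"
  shows "wedge (ext_vec v) (ext_prod vs) = 0"
proof -
  obtain B where B: "B \<subseteq> V" "vec.independent B" "V \<subseteq> vec.span B" "card B = vec.dim V"
    by (rule vec.basis_exists[of V])
  have "finite B" using B(2) by (rule vec.finiteI_independent)
  moreover have "set (v # vs) \<subseteq> vec.span B" using assms(2,3) B(3) by auto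
  ultimately have "ext_prod (v # vs) = 0"
    using B(4) assms(1,4) by (intro ext_prod_eq_0_of_small_span[of _ B]) auto
  then show ?thesis by simp
qed

text \<open>
  The value at \<open>n + 1\<close> is zero, so differences of these vectors treat all classes alike.
\<close>

definition class_vector :: "nat \<Rightarrow> (nat \<Rightarrow> 'l set) \<Rightarrow> nat \<Rightarrow> (complex, 'l::finite) vec" where
  "class_vector n P i = (\<Sum>j\<in>P i. axis j 1) - (\<Sum>j\<in>P (n + 1). axis j 1)"

lemma partition_generators_eq: "partition_generators n P = class_vector n P ` {1..n}"
  by (auto simp: partition_generators_def class_vector_def)

lemma class_vector_nth:
  "class_vector n P i $ k = (if k \<in> P i then 1 else 0) - (if k \<in> P (n + 1) then 1 else 0)"
proof -
  have "(\<Sum>j\<in>A. axis j 1 :: (complex, 'a) vec) $ k = (if k \<in> A then 1 else 0)" for A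
  proof -
    have "(\<Sum>j\<in>A. axis j 1 :: (complex, 'a) vec) $ k = (\<Sum>j\<in>A. if j = k then 1 else 0)"
      unfolding sum_component by (intro sum.cong) (auto simp: axis_def)
    then show ?thesis by simp
  qed
  then show ?thesis by (simp only: class_vector_def vector_minus_component)
qed

section \<open>From an isotropic subspace to a partition\<close>

locale isotropic_innc_arrangement = generic_innc_arrangement H \<alpha> n
  for H :: "'l::{finite,linorder} \<Rightarrow> (complex ^ 'm) set set"
    and \<alpha> :: "'l \<Rightarrow> complex ^ 'm"
    and n :: nat +
  fixes V :: "(complex, 'l) vec set"
  assumes full_isotropic: "full_isotropic H n V"
begin

lemma subspace_V: "vec.subspace V" and dim_V: "vec.dim V = n"
  using full_isotropic by (auto simp: full_isotropic_def isotropic_def)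

lemma coordinate_nonzero: "\<exists>v\<in>V. v $ j \<noteq> 0"
  using full_isotropic by (auto simp: full_isotropic_def coordinate_hyperplane_def)

lemma card_basis: "coordinate_basis V T \<Longrightarrow> card T = n"
  by (simp add: coordinate_basis_def dim_V)

text \<open>
  Let \<open>w\<close> be the product of the dual basis.  Its coefficient at \<open>T\<close> is \<open>1\<close>, so isotropy puts \<open>T\<close> into a
  circuit \<open>S\<close>.  For \<open>v \<in> V\<close> the product of \<open>v\<close> and \<open>w\<close> has \<open>n + 1\<close> factors from \<open>V\<close> and vanishes; by the
  circuit condition its coefficient at \<open>S\<close> is a nonzero multiple of the sum of the coordinates of \<open>v\<close>
  over \<open>S\<close>.
\<close>

lemma coordinate_basis_circuit:
  assumes T: "coordinate_basis V T"
  shows "\<exists>k. k \<notin> T \<and> circuit (insert k T) \<and> (\<forall>v\<in>V. v $ k + (\<Sum>t\<in>T. v $ t) = 0)"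
proof -
  obtain b where b: "\<And>s. s \<in> T \<Longrightarrow> b s \<in> V"
    "\<And>s t. s \<in> T \<Longrightarrow> t \<in> T \<Longrightarrow> b s $ t = (if s = t then 1 else 0)"
    using coordinate_basis_dual[OF subspace_V T] by blast
  define vs where "vs = map b (sorted_list_of_set T)"
  have vs: "set vs \<subseteq> V" "length vs = n"
    using b(1) card_basis[OF T] by (auto simp: vs_def)
  define w where "w = ext_prod vs"
  have "w \<in> os_ideal H"
    using full_isotropic vs by (simp add: full_isotropic_def isotropic_iff w_def)
  then have w: "circuit_condition w" by (rule os_ideal_imp_circuit_condition)
  have wT: "w $ T = 1"
    unfolding w_def vs_def by (rule ext_prod_nth_dual_family) (rule b(2))
  obtain S where S: "circuit S" "T \<subseteq> S"
    using circuit_conditionD(2)[OF w card_basis[OF T]] wT by (metis zero_neq_one)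
  have "card (S - T) = 1"
    using S circuit_card card_basis[OF T] by (simp add: card_Diff_subset)
  then obtain k where "S - T = {k}" by (rule card_1_singletonE)
  then have k: "k \<notin> T" "S = insert k T" using S(2) by auto
  have nz: "wedge (ext_gen k) w $ S \<noteq> 0"
    using k wT by (simp add: wedge_ext_gen_nth)
  have "v $ k + (\<Sum>t\<in>T. v $ t) = 0" if v: "v \<in> V" for v
  proof -
    have "0 = wedge (ext_vec v) w $ S"
      using wedge_ext_prod_eq_0[OF dim_V v vs] by (simp add: w_def)
    also have "\<dots> = (\<Sum>i\<in>S. v $ i * wedge (ext_gen k) w $ S)"
      unfolding wedge_ext_vec_nth[of v w S]
    proof (intro sum.cong refl)
      fix i assume "i \<in> S"
      then have "wedge (ext_gen i) w $ S = wedge (ext_gen k) w $ S"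
        by (rule circuit_conditionD(3)[OF w S(1)]) (simp add: k(2))
      then show "v $ i * wedge (ext_gen i) w $ S = v $ i * wedge (ext_gen k) w $ S" by simp
    qed
    also have "\<dots> = (\<Sum>i\<in>S. v $ i) * wedge (ext_gen k) w $ S"
      by (simp add: sum_distrib_right)
    finally have "(\<Sum>i\<in>S. v $ i) = 0" using nz by simp
    then show ?thesis using k by simp
  qed
  then show ?thesis using k S(1) by blast
qed

lemma n_ge_2: "n \<ge> 2"
  using exists_coordinate_basis[OF subspace_V] coordinate_basis_circuit circuit_imp_ge_2 by blast

text \<open>
  The support of \<open>w\<close> consists of the coordinates outside the span of \<open>T - {t}\<close>.  The circuit that extends
  \<open>T - {t}\<close> and such a \<open>j\<close> contains one more element \<open>k j\<close>.  Since two circuits with \<open>n\<close> common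
  elements are equal, \<open>k\<close> is an involution of the support, and each pair \<open>j\<close>, \<open>k j\<close> contributes the same
  sum.
\<close>

lemma sum_over_support:
  assumes T: "coordinate_basis V T" "t \<in> T" and w: "w \<in> V" "\<And>r. r \<in> T - {t} \<Longrightarrow> w $ r = 0"
    and v: "v \<in> V"
  shows "2 * (\<Sum>j | w $ j \<noteq> 0. v $ j) = - of_nat (card {j. w $ j \<noteq> 0}) * (\<Sum>r\<in>T - {t}. v $ r)"
proof -
  let ?N = "{j. w $ j \<noteq> 0}"
  let ?R = "T - {t}"
  have "\<forall>j\<in>?N. \<exists>k. k \<notin> insert j ?R \<and> circuit (insert k (insert j ?R)) \<and>
      (\<forall>v\<in>V. v $ k + (\<Sum>i\<in>insert j ?R. v $ i) = 0)"
    using coordinate_basis_exchange[OF subspace_V T(1) w(1) T(2) w(2)]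
      coordinate_basis_circuit by blast
  then obtain k where k: "\<And>j. j \<in> ?N \<Longrightarrow> k j \<notin> insert j ?R"
    "\<And>j. j \<in> ?N \<Longrightarrow> circuit (insert (k j) (insert j ?R))"
    "\<And>j v. j \<in> ?N \<Longrightarrow> v \<in> V \<Longrightarrow> v $ k j + (\<Sum>i\<in>insert j ?R. v $ i) = 0"
    by metis
  have notR: "j \<notin> ?R" if "j \<in> ?N" for j using that w(2) by blast
  have rel: "u $ k j + u $ j + (\<Sum>i\<in>?R. u $ i) = 0" if "j \<in> ?N" "u \<in> V" for j u
    using k(3)[OF that] notR[OF that(1)] by (simp add: add.assoc)
  have kN: "k j \<in> ?N" if j: "j \<in> ?N" for j
  proof -
    have "(\<Sum>i\<in>?R. w $ i) = 0" using w(2) by (intro sum.neutral) blast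
    then show ?thesis using rel[OF j w(1)] j by (auto simp: add_eq_0_iff2)
  qed
  have kk: "k (k j) = j" if j: "j \<in> ?N" for j
  proof -
    have "card (insert (k j) ?R) = n"
      using k(1)[OF j] card_basis[OF T(1)] T(2) card_Suc_Diff1[of T t] by simp
    then have "insert (k (k j)) (insert (k j) ?R) = insert (k j) (insert j ?R)"
      by (intro circuit_unique[OF k(2)[OF kN[OF j]] k(2)[OF j], of "insert (k j) ?R"]) auto
    moreover have "k (k j) \<notin> insert (k j) ?R" using k(1)[OF kN[OF j]] by blast
    ultimately show ?thesis by blast
  qed
  have "bij_betw k ?N ?N"
    by (rule bij_betw_byWitness[where f' = k]) (use kN kk in auto)
  then have "(\<Sum>j\<in>?N. v $ k j) = (\<Sum>j\<in>?N. v $ j)"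
    by (rule sum.reindex_bij_betw)
  moreover have "(\<Sum>j\<in>?N. v $ k j + v $ j + (\<Sum>i\<in>?R. v $ i)) = 0"
    using rel v by (intro sum.neutral) auto
  ultimately show ?thesis
    by (simp add: sum.distrib eq_neg_iff_add_eq_0)
qed

text \<open>
  The coordinates in \<open>T - {s}\<close> vanish at the dual vector \<open>b s\<close>, so the previous lemma, applied to \<open>b s\<close>
  in both places, shows that the coordinates of \<open>b s\<close> add up to zero; and these vectors span \<open>V\<close>.
\<close>

lemma sum_coordinates:
  assumes v: "v \<in> V"
  shows "(\<Sum>j\<in>UNIV. v $ j) = 0"
proof -
  obtain T where T: "coordinate_basis V T"
    using exists_coordinate_basis[OF subspace_V] by blast
  obtain b where b: "\<And>s. s \<in> T \<Longrightarrow> b s \<in> V"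
    "\<And>s t. s \<in> T \<Longrightarrow> t \<in> T \<Longrightarrow> b s $ t = (if s = t then 1 else 0)"
    using coordinate_basis_dual[OF subspace_V T] by blast
  have "(\<Sum>j\<in>UNIV. b s $ j) = 0" if s: "s \<in> T" for s
  proof -
    have z: "b s $ r = 0" if "r \<in> T - {s}" for r using b(2)[of s r] s that by auto
    then have "(\<Sum>r\<in>T - {s}. b s $ r) = 0" by (intro sum.neutral) blast
    then have "(\<Sum>j | b s $ j \<noteq> 0. b s $ j) = 0"
      using sum_over_support[OF T s b(1)[OF s] z b(1)[OF s]] by simp
    moreover have "(\<Sum>j\<in>UNIV. b s $ j) = (\<Sum>j | b s $ j \<noteq> 0. b s $ j)"
      by (intro sum.mono_neutral_right) auto
    ultimately show ?thesis by simp
  qed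
  moreover have "(\<Sum>j\<in>UNIV. v $ j) = (\<Sum>j\<in>UNIV. (\<Sum>s\<in>T. v $ s *s b s) $ j)"
    using coordinate_basis_expand[OF subspace_V T b v] by simp
  moreover have "(\<Sum>j\<in>UNIV. (\<Sum>s\<in>T. v $ s *s b s) $ j) = (\<Sum>s\<in>T. v $ s * (\<Sum>j\<in>UNIV. b s $ j))"
    by (simp add: sum_component sum_distrib_left sum.swap[of _ UNIV])
  ultimately show ?thesis by simp
qed

lemma sum_off_support:
  assumes "coordinate_basis V T" "t \<in> T" "w \<in> V" "\<And>r. r \<in> T - {t} \<Longrightarrow> w $ r = 0" "v \<in> V"
  shows "2 * (\<Sum>j | w $ j = 0. v $ j) = of_nat (card {j. w $ j \<noteq> 0}) * (\<Sum>r\<in>T - {t}. v $ r)"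
proof -
  have "UNIV = {j. w $ j = 0} \<union> {j. w $ j \<noteq> 0}" by auto
  then have "(\<Sum>j | w $ j = 0. v $ j) + (\<Sum>j | w $ j \<noteq> 0. v $ j) = (\<Sum>j\<in>UNIV. v $ j)"
    by (metis (mono_tags, lifting) sum.union_disjoint finite disjoint_iff mem_Collect_eq)
  then have "(\<Sum>j | w $ j = 0. v $ j) = - (\<Sum>j | w $ j \<noteq> 0. v $ j)"
    using sum_coordinates[OF assms(5)] by (simp add: eq_neg_iff_add_eq_0)
  then show ?thesis using sum_over_support[OF assms] by simp
qed

definition copies :: "'l \<Rightarrow> 'l set" where
  "copies j = {i. \<forall>v\<in>V. v $ i = v $ j}"

text \<open>
  The coordinate \<open>j\<close> lies in the span of \<open>T - {t}\<close> and can replace \<open>r\<close> there.  The span, hence the left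
  side of \<open>sum_off_support\<close>, stays the same, so the sum of the basis stays the same as well.
\<close>

lemma copies_of_exchange:
  assumes T: "coordinate_basis V T" "t \<in> T" "r \<in> T" "r \<noteq> t"
    and w: "w \<in> V" "\<And>i. i \<in> T - {t} \<Longrightarrow> w $ i = 0" "w $ t \<noteq> 0" "w $ j = 0"
    and u: "u \<in> V" "\<And>i. i \<in> T - {r} \<Longrightarrow> u $ i = 0" "u $ j \<noteq> 0"
  shows "j \<in> copies r"
  unfolding copies_def
proof (intro CollectI ballI)
  fix v assume v: "v \<in> V"
  let ?T' = "insert j (T - {r})"
  have T': "coordinate_basis V ?T'"
    by (rule coordinate_basis_exchange[OF subspace_V T(1) u(1) T(3) u(2,3)])
  have j: "j \<notin> T - {r}" "j \<noteq> t" using u w by blast+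
  have "of_nat (card {i. w $ i \<noteq> 0}) * (\<Sum>i\<in>T - {t}. v $ i) =
      of_nat (card {i. w $ i \<noteq> 0}) * (\<Sum>i\<in>?T' - {t}. v $ i)"
    using sum_off_support[OF T(1,2) w(1,2) v] sum_off_support[OF T' _ w(1) _ v, of t] T w by auto
  moreover have "card {i. w $ i \<noteq> 0} \<noteq> 0" using w(3) by auto
  ultimately have "(\<Sum>i\<in>T - {t}. v $ i) = (\<Sum>i\<in>?T' - {t}. v $ i)" by simp
  moreover have "T - {t} = insert r (T - {r} - {t})" "?T' - {t} = insert j (T - {r} - {t})"
    using T j by auto
  ultimately show "v $ j = v $ r" using j by simp
qed

text \<open>
  A coordinate that vanishes at \<open>b t\<close> is nonzero at some other dual vector \<open>b s\<close>, since it does not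
  vanish on \<open>V\<close>; exchanging it for \<open>s\<close> shows that it is a copy of \<open>s\<close>.
\<close>

lemma zeros_eq_copies:
  assumes T: "coordinate_basis V T" "t \<in> T"
    and b: "\<And>s. s \<in> T \<Longrightarrow> b s \<in> V" "\<And>s t. s \<in> T \<Longrightarrow> t \<in> T \<Longrightarrow> b s $ t = (if s = t then 1 else 0)"
  shows "{j. b t $ j = 0} = (\<Union>r\<in>T - {t}. copies r)"
proof (intro equalityI subsetI)
  fix j assume "j \<in> {j. b t $ j = 0}"
  then have j: "b t $ j = 0" by simp
  obtain v where v: "v \<in> V" "v $ j \<noteq> 0" using coordinate_nonzero by blast
  have "v $ j = (\<Sum>s\<in>T. v $ s *s b s) $ j"
    using coordinate_basis_expand[OF subspace_V T(1) b v(1)] by simp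
  then have "(\<Sum>s\<in>T. v $ s * b s $ j) \<noteq> 0" using v(2) by (simp add: sum_component)
  then obtain s where s: "s \<in> T" "b s $ j \<noteq> 0"
    by (metis (no_types, lifting) mult_zero_right sum.neutral)
  then have st: "s \<noteq> t" using j by auto
  have "j \<in> copies s"
    by (rule copies_of_exchange[OF T s(1) st b(1)[OF T(2)] _ _ j b(1)[OF s(1)] _ s(2)])
      (use b(2) T(2) s(1) in auto)
  then show "j \<in> (\<Union>r\<in>T - {t}. copies r)" using s(1) st by blast
next
  fix j assume "j \<in> (\<Union>r\<in>T - {t}. copies r)"
  then obtain r where "r \<in> T" "r \<noteq> t" "j \<in> copies r" by blast
  then show "j \<in> {j. b t $ j = 0}"
    using b T(2) by (auto simp: copies_def)
qed

lemma copies_disjoint: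
  assumes "coordinate_basis V T" "r \<in> T" "s \<in> T" "r \<noteq> s"
  shows "copies r \<inter> copies s = {}"
proof -
  obtain b where "\<And>s. s \<in> T \<Longrightarrow> b s \<in> V"
    "\<And>s t. s \<in> T \<Longrightarrow> t \<in> T \<Longrightarrow> b s $ t = (if s = t then 1 else 0)"
    using coordinate_basis_dual[OF subspace_V assms(1)] by blast
  then have "b r \<in> V" "b r $ r \<noteq> b r $ s" using assms by auto
  then show ?thesis by (fastforce simp: copies_def)
qed

text \<open>
  Evaluating \<open>sum_off_support\<close> at the dual vectors gives every element of \<open>T - {t}\<close> half as many copies as
  there are coordinates outside their span.  With \<open>c\<close> copies each, there are \<open>(n - 1) * c\<close> coordinates
  inside the span and \<open>2 * c\<close> outside.
\<close>

lemma card_copies: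
  assumes T: "coordinate_basis V T" "r \<in> T"
  shows "(n + 1) * card (copies r) = CARD('l)"
proof -
  have "card (T - {r}) \<noteq> 0" using T n_ge_2 card_basis by simp
  then have "T - {r} \<noteq> {}" by fastforce
  then obtain t where t: "t \<in> T" "t \<noteq> r" by blast
  obtain b where b: "\<And>s. s \<in> T \<Longrightarrow> b s \<in> V"
    "\<And>s t. s \<in> T \<Longrightarrow> t \<in> T \<Longrightarrow> b s $ t = (if s = t then 1 else 0)"
    using coordinate_basis_dual[OF subspace_V T(1)] by blast
  let ?N = "{j. b t $ j \<noteq> 0}"
  have zeros: "{j. b t $ j = 0} = (\<Union>s\<in>T - {t}. copies s)"
    by (rule zeros_eq_copies[OF T(1) t(1) b])
  have disj: "\<forall>s\<in>T - {t}. \<forall>s'\<in>T - {t}. s \<noteq> s' \<longrightarrow> copies s \<inter> copies s' = {}"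
    using copies_disjoint[OF T(1)] by blast
  have zt: "b t $ r = 0" if "r \<in> T - {t}" for r using b(2)[of t r] t(1) that by auto
  have half: "2 * card (copies s) = card ?N" if s: "s \<in> T - {t}" for s
  proof -
    have "(\<Sum>j | b t $ j = 0. b s $ j) = (\<Sum>s'\<in>T - {t}. \<Sum>j\<in>copies s'. b s $ j)"
      unfolding zeros using disj by (intro sum.UNION_disjoint) auto
    also have "\<dots> = (\<Sum>s'\<in>T - {t}. if s' = s then of_nat (card (copies s)) else 0)"
    proof (intro sum.cong refl)
      fix s' assume s': "s' \<in> T - {t}"
      have "(\<Sum>j\<in>copies s'. b s $ j) = (\<Sum>j\<in>copies s'. b s $ s')"
        using b(1) s by (intro sum.cong) (auto simp: copies_def)
      then show "(\<Sum>j\<in>copies s'. b s $ j) = (if s' = s then of_nat (card (copies s)) else 0)"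
        using b(2) s s' by auto
    qed
    also have "\<dots> = of_nat (card (copies s))" using s by simp
    finally have "2 * of_nat (card (copies s)) = of_nat (card ?N) * (\<Sum>r\<in>T - {t}. b s $ r)"
      using sum_off_support[OF T(1) t(1) b(1)[OF t(1)] zt b(1)[of s]] s by simp
    also have "(\<Sum>r\<in>T - {t}. b s $ r) = (\<Sum>r\<in>T - {t}. if r = s then 1 else 0)"
      using b(2) s by (intro sum.cong) auto
    also have "\<dots> = 1" using s by simp
    finally have "(of_nat (2 * card (copies s)) :: complex) = of_nat (card ?N)" by simp
    then show ?thesis by (simp only: of_nat_eq_iff)
  qed
  have "card {j. b t $ j = 0} = (\<Sum>s\<in>T - {t}. card (copies s))"
    unfolding zeros using disj by (intro card_UN_disjoint) auto
  also have "\<dots> = (\<Sum>s\<in>T - {t}. card (copies r))"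
    using half half[of r] T(2) t by (intro sum.cong) (auto, metis DiffI Suc_1 mult_left_cancel nat.distinct(1) singletonD)
  also have "\<dots> = (n - 1) * card (copies r)"
    using t(1) card_basis[OF T(1)] by simp
  finally have "card {j. b t $ j = 0} = (n - 1) * card (copies r)" .
  moreover have "CARD('l) = card {j. b t $ j = 0} + card ?N"
  proof -
    have "UNIV = {j. b t $ j = 0} \<union> ?N" by auto
    then show ?thesis by (metis (mono_tags, lifting) card_Un_disjoint disjoint_iff finite mem_Collect_eq)
  qed
  moreover have "card ?N = 2 * card (copies r)" using half[of r] T(2) t(2) by simp
  ultimately have "CARD('l) = (n - 1) * card (copies r) + 2 * card (copies r)" by simp
  also have "\<dots> = (n - 1 + 2) * card (copies r)" by (simp only: add_mult_distrib)
  also have "n - 1 + 2 = n + 1" using n_ge_2 by simp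
  finally show ?thesis by simp
qed

text \<open>
  Representatives are the elements of a circuit that extends a coordinate basis: any \<open>n\<close> of them form a
  coordinate basis again, and their \<open>n + 1\<close> disjoint classes exhaust all coordinates by counting.
\<close>

lemma exists_class_representatives:
  obtains e m where "\<And>q. q \<in> {1..n+1} \<Longrightarrow> coordinate_basis V (e ` ({1..n+1} - {q}))"
    "inj_on e {1..n+1}"
    "\<And>v. v \<in> V \<Longrightarrow> (\<Sum>i\<in>{1..n+1}. v $ e i) = 0"
    "\<And>i. i \<in> {1..n+1} \<Longrightarrow> card (copies (e i)) = m"
    "\<And>i k. i \<in> {1..n+1} \<Longrightarrow> k \<in> {1..n+1} \<Longrightarrow> i \<noteq> k \<Longrightarrow> copies (e i) \<inter> copies (e k) = {}"
    "\<And>j. \<exists>i\<in>{1..n+1}. j \<in> copies (e i)"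
proof -
  obtain T where T: "coordinate_basis V T"
    using exists_coordinate_basis[OF subspace_V] by blast
  obtain k where k: "k \<notin> T" "\<And>v. v \<in> V \<Longrightarrow> v $ k + (\<Sum>t\<in>T. v $ t) = 0"
    using coordinate_basis_circuit[OF T] by blast
  let ?S = "insert k T"
  have card_S: "card ?S = n + 1" using k(1) card_basis[OF T] by simp
  have sum_S: "(\<Sum>s\<in>?S. v $ s) = 0" if "v \<in> V" for v using k that by simp
  have basis: "coordinate_basis V (?S - {s})" if s: "s \<in> ?S" for s
  proof -
    have "v = 0" if v: "v \<in> V" "\<forall>t\<in>?S - {s}. v $ t = 0" for v
    proof -
      have "(\<Sum>s\<in>?S. v $ s) = v $ s + (\<Sum>s\<in>?S - {s}. v $ s)"
        by (rule sum.remove) (use s in auto)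
      also have "(\<Sum>s\<in>?S - {s}. v $ s) = 0" using v(2) by (intro sum.neutral) blast
      finally have "v $ s = 0" using sum_S[OF v(1)] by simp
      then have "\<forall>t\<in>T. v $ t = 0" using v(2) by blast
      then show ?thesis using T v(1) by (simp add: coordinate_basis_def)
    qed
    moreover have "card (?S - {s}) = n" using card_S s by simp
    ultimately show ?thesis by (simp add: coordinate_basis_def dim_V)
  qed
  obtain e where e: "bij_betw e {1..n+1} ?S"
    using ex_bij_betw_nat_finite_1[of ?S] card_S by auto
  have inj: "inj_on e {1..n+1}" and im: "e ` {1..n+1} = ?S"
    using e by (auto simp: bij_betw_def)
  define m where "m = CARD('l) div (n + 1)"
  have card_c: "card (copies (e i)) = m" if i: "i \<in> {1..n+1}" for i
  proof -
    have "card (?S - {e i}) \<noteq> 0" using card_S i im n_ge_2 by (subst card_Diff_singleton) auto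
    then have "?S - {e i} \<noteq> {}" by fastforce
    then obtain s where s: "s \<in> ?S" "s \<noteq> e i" by blast
    have "(n + 1) * card (copies (e i)) = CARD('l)"
      using card_copies[OF basis[OF s(1)], of "e i"] s i im by blast
    then show ?thesis unfolding m_def by (metis add_is_0 nonzero_mult_div_cancel_left one_neq_zero)
  qed
  have disj: "copies (e i) \<inter> copies (e k) = {}"
    if ik: "i \<in> {1..n+1}" "k \<in> {1..n+1}" "i \<noteq> k" for i k
  proof -
    have ne: "e i \<noteq> e k" using ik inj by (auto dest: inj_onD)
    have "card {e i, e k} < card ?S" using card_S n_ge_2 card_insert_le_m1[of 2 "{e k}" "e i"] by simp
    then have "\<not> ?S \<subseteq> {e i, e k}" using card_mono[of "{e i, e k}" ?S] by auto
    then obtain s where s: "s \<in> ?S" "s \<noteq> e i" "s \<noteq> e k" by blast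
    show ?thesis
      using copies_disjoint[OF basis[OF s(1)], of "e i" "e k"] ik im ne s by blast
  qed
  have "card (\<Union>i\<in>{1..n+1}. copies (e i)) = (\<Sum>i\<in>{1..n+1}. card (copies (e i)))"
    using disj by (intro card_UN_disjoint) auto
  also have "\<dots> = (n + 1) * m" using card_c by simp
  also have "\<dots> = CARD('l)"
  proof -
    obtain s where s: "s \<in> T" using card_basis[OF T] n_ge_2 by fastforce
    then have "(n + 1) * card (copies s) = CARD('l)" by (rule card_copies[OF T])
    then show ?thesis unfolding m_def by (metis dvd_mult_div_cancel dvd_triv_left)
  qed
  finally have "(\<Union>i\<in>{1..n+1}. copies (e i)) = UNIV"
    by (intro card_subset_eq) auto
  then have cover: "\<exists>i\<in>{1..n+1}. j \<in> copies (e i)" for j by blast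
  have "coordinate_basis V (e ` ({1..n+1} - {q}))" if q: "q \<in> {1..n+1}" for q
  proof -
    have "e ` ({1..n+1} - {q}) = ?S - {e q}"
      using inj im q by (auto simp: inj_on_def)
    moreover have "e q \<in> ?S" using q im by blast
    ultimately show ?thesis using basis[of "e q"] by simp
  qed
  moreover have "(\<Sum>i\<in>{1..n+1}. v $ e i) = 0" if "v \<in> V" for v
    using sum_S[OF that] sum.reindex_bij_betw[OF e, of "\<lambda>s. v $ s"] by simp
  ultimately show ?thesis using that inj card_c disj cover by blast
qed

text \<open>
  Choosing one hyperplane from each class except \<open>q\<close> gives a coordinate basis, and the circuit that
  contains it is completed by a copy of the representative of \<open>q\<close>, because both complete the sum to
  zero.  This makes the classes a net, to which Noether's theorem applies.
\<close>

theorem exists_pencil_partition: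
  "\<exists>P. pencil_partition \<alpha> n P \<and> V = vec.span (partition_generators n P)"
proof -
  let ?I = "{1..n+1}"
  obtain e m where e_basis: "\<And>q. q \<in> ?I \<Longrightarrow> coordinate_basis V (e ` (?I - {q}))"
    and inj: "inj_on e ?I"
    and e_sum: "\<And>v. v \<in> V \<Longrightarrow> (\<Sum>i\<in>?I. v $ e i) = 0"
    and card_P: "\<And>i. i \<in> ?I \<Longrightarrow> card (copies (e i)) = m"
    and disj: "\<And>i k. i \<in> ?I \<Longrightarrow> k \<in> ?I \<Longrightarrow> i \<noteq> k \<Longrightarrow> copies (e i) \<inter> copies (e k) = {}"
    and cover: "\<And>j. \<exists>i\<in>?I. j \<in> copies (e i)"
    by (rule exists_class_representatives) blast
  define P where "P = (\<lambda>i. copies (e i))"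
  have e_in: "e i \<in> P i" for i by (simp add: P_def copies_def)
  have same: "v $ j = v $ e i" if "j \<in> P i" "v \<in> V" for i j v
    using that by (simp add: P_def copies_def)
  have class_eq: "i = k" if "j \<in> P i" "j \<in> P k" "i \<in> ?I" "k \<in> ?I" for i j k
    using disj[of i k] that by (auto simp: P_def)
  have transversal: "\<exists>s. circuit (insert s (r ` (?I - {q}))) \<and> s \<in> P q \<and> card (r ` (?I - {q})) = n"
    if q: "q \<in> ?I" and r: "\<And>i. i \<in> ?I - {q} \<Longrightarrow> r i \<in> P i" for q r
  proof -
    let ?T = "r ` (?I - {q})"
    have inj_r: "inj_on r (?I - {q})"
    proof (rule inj_onI)
      fix i k assume "i \<in> ?I - {q}" "k \<in> ?I - {q}" "r i = r k"
      then show "i = k" using class_eq[of "r i" i k] r[of i] r[of k] by simp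
    qed
    have card_T: "card ?T = n" using inj_r q by (simp add: card_image)
    have "v = 0" if v: "v \<in> V" "\<forall>t\<in>?T. v $ t = 0" for v
    proof -
      have "v $ e i = 0" if "i \<in> ?I - {q}" for i
        using v that same[OF r[OF that] v(1)] by auto
      then show ?thesis using e_basis[OF q] v(1) by (auto simp: coordinate_basis_def)
    qed
    then have "coordinate_basis V ?T" using card_T by (auto simp: coordinate_basis_def dim_V)
    then obtain s where s: "circuit (insert s ?T)" "\<And>v. v \<in> V \<Longrightarrow> v $ s + (\<Sum>t\<in>?T. v $ t) = 0"
      using coordinate_basis_circuit by blast
    have "v $ s = v $ e q" if v: "v \<in> V" for v
    proof -
      have "(\<Sum>t\<in>?T. v $ t) = (\<Sum>i\<in>?I - {q}. v $ r i)"
        by (subst sum.reindex[OF inj_r]) simp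
      also have "\<dots> = (\<Sum>i\<in>?I - {q}. v $ e i)"
        using same r v by (intro sum.cong) auto
      finally have "v $ s + (\<Sum>i\<in>?I - {q}. v $ e i) = 0" using s(2)[OF v] by simp
      moreover have "v $ e q + (\<Sum>i\<in>?I - {q}. v $ e i) = 0"
        using e_sum[OF v] sum.remove[OF _ q, of "\<lambda>i. v $ e i"] by simp
      ultimately show ?thesis by (metis add_right_cancel)
    qed
    then show ?thesis using s(1) card_T by (auto simp: P_def copies_def)
  qed
  interpret net: net_of_forms \<alpha> P n m
  proof
    show "CARD('m) = n + 1" by (rule card_coordinates)
    show "card (P i) = m" if "i \<in> ?I" for i using card_P that by (simp add: P_def)
    show "P i \<noteq> {}" for i using e_in by auto
  next
    fix q z i
    assume q: "q \<in> ?I" and z: "z \<noteq> 0" and i: "i \<in> ?I"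
      and van: "\<And>i. i \<in> ?I - {q} \<Longrightarrow> \<exists>j\<in>P i. lin_form (\<alpha> j) z = 0"
    have "\<forall>i\<in>?I - {q}. \<exists>j. j \<in> P i \<and> lin_form (\<alpha> j) z = 0" using van by blast
    then obtain r where r: "\<And>i. i \<in> ?I - {q} \<Longrightarrow> r i \<in> P i \<and> lin_form (\<alpha> (r i)) z = 0"
      by (metis (no_types))
    obtain s where s: "circuit (insert s (r ` (?I - {q})))" "s \<in> P q" "card (r ` (?I - {q})) = n"
      using transversal[OF q, of r] r by blast
    have "vanishing z = insert s (r ` (?I - {q}))"
      by (rule vanishing_eq_circuit[OF s(1) _ s(3) z]) (use r in \<open>auto simp: vanishing_def\<close>)
    then have zero: "lin_form (\<alpha> j) z = 0 \<longleftrightarrow> j = s \<or> j \<in> r ` (?I - {q})" for j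
      by (auto simp: vanishing_def)
    define r' where "r' = r(q := s)"
    have zero': "lin_form (\<alpha> j) z = 0 \<longleftrightarrow> (\<exists>i\<in>?I. j = r' i)" for j
      unfolding zero r'_def using q by auto
    have r': "r' i \<in> P i" if "i \<in> ?I" for i using r s(2) that by (auto simp: r'_def)
    show "\<exists>!j. j \<in> P i \<and> lin_form (\<alpha> j) z = 0"
    proof (rule ex1I[of _ "r' i"])
      show "r' i \<in> P i \<and> lin_form (\<alpha> (r' i)) z = 0" using r' i zero' by blast
      fix j assume "j \<in> P i \<and> lin_form (\<alpha> j) z = 0"
      then obtain i' where "j \<in> P i" "i' \<in> ?I" "j = r' i'" using zero' by blast
      then show "j = r' i" using class_eq[of j i i'] r' i by blast
    qed
  next
    fix q r z w
    assume q: "q \<in> ?I" and z: "z \<noteq> 0"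
      and r: "\<And>i. i \<in> ?I - {q} \<Longrightarrow> r i \<in> P i \<and> lin_form (\<alpha> (r i)) z = 0 \<and> lin_form (\<alpha> (r i)) w = 0"
    obtain s where s: "circuit (insert s (r ` (?I - {q})))" "card (r ` (?I - {q})) = n"
      using transversal[OF q, of r] r by blast
    show "w \<in> vec.span {z}"
      by (rule circuit_point_unique[OF s(1) _ s(2) _ _ z]) (use r in \<open>auto simp: vanishing_def\<close>)
  qed
  have "pencil_partition \<alpha> n P"
    unfolding pencil_partition_def
  proof (intro conjI)
    show "inj_on P ?I"
    proof (rule inj_onI)
      fix i k assume "i \<in> ?I" "k \<in> ?I" "P i = P k"
      then show "i = k" using class_eq[of "e i" i k] e_in[of i] by simp
    qed
    show "partition_on UNIV (P ` ?I)"
    proof (rule partition_onI)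
      show "\<Union> (P ` ?I) = UNIV" using cover by (auto simp: P_def)
      show "disjnt p p'" if pp: "p \<in> P ` ?I" "p' \<in> P ` ?I" "p \<noteq> p'" for p p'
      proof -
        obtain i k where ik: "i \<in> ?I" "k \<in> ?I" "p = P i" "p' = P k" using pp by blast
        then have "i \<noteq> k" using pp(3) by blast
        then show ?thesis using disj[of i k] ik by (simp add: disjnt_def P_def)
      qed
      show "{} \<notin> P ` ?I" using e_in by blast
    qed
    show "\<forall>i\<in>?I. \<forall>j\<in>?I. card (P i) = card (P j)" using card_P by (simp add: P_def)
    show "\<exists>a. (\<forall>i\<in>?I. a i \<noteq> 0) \<and> (\<forall>z. (\<Sum>i = 1..n+1. a i * (\<Prod>j\<in>P i. lin_form (\<alpha> j) z)) = 0)"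
      using net.class_products_dependent unfolding net.class_product_def .
  qed
  moreover have "V = vec.span (partition_generators n P)"
  proof (rule vec.subspace_dim_equal[OF subspace_V vec.subspace_span])
    show "V \<subseteq> vec.span (partition_generators n P)"
    proof
      fix v assume v: "v \<in> V"
      have "v = (\<Sum>i\<in>{1..n}. v $ e i *s class_vector n P i)"
      proof (subst vec_eq_iff, intro allI)
        fix k
        obtain q where q: "q \<in> ?I" "k \<in> P q" using cover[of k] unfolding P_def by blast
        have mem: "k \<in> P i \<longleftrightarrow> i = q" if "i \<in> ?I" for i using class_eq q that by blast
        have "(\<Sum>i\<in>{1..n}. v $ e i *s class_vector n P i) $ k =
            (\<Sum>i\<in>{1..n}. v $ e i * ((if i = q then 1 else 0) - (if n + 1 = q then 1 else 0)))"
          unfolding sum_component using mem by (intro sum.cong) (auto simp: class_vector_nth)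
        also have "\<dots> = v $ e q"
        proof (cases "q = n + 1")
          case True
          then have "(\<Sum>i\<in>{1..n}. v $ e i * ((if i = q then 1 else 0) - (if n + 1 = q then 1 else 0))) =
              - (\<Sum>i\<in>{1..n}. v $ e i)"
            unfolding sum_negf[symmetric] by (intro sum.cong) auto
          also have "\<dots> = v $ e q"
            using e_sum[OF v] True by (simp add: neg_eq_iff_add_eq_0 add.commute)
          finally show ?thesis .
        next
          case False
          then have "(\<Sum>i\<in>{1..n}. v $ e i * ((if i = q then 1 else 0) - (if n + 1 = q then 1 else 0))) =
              (\<Sum>i\<in>{1..n}. if i = q then v $ e i else 0)"
            by (intro sum.cong) auto
          then show ?thesis using q False by simp
        qed
        also have "\<dots> = v $ k" using same q v by simp
        finally show "v $ k = (\<Sum>i\<in>{1..n}. v $ e i *s class_vector n P i) $ k" by simp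
      qed
      also have "\<dots> \<in> vec.span (partition_generators n P)"
        unfolding partition_generators_eq by (intro vec.span_sum vec.span_scale vec.span_base) auto
      finally show "v \<in> vec.span (partition_generators n P)" .
    qed
    have "vec.dim (vec.span (partition_generators n P)) \<le> card (partition_generators n P)"
      unfolding partition_generators_eq by (intro vec.dim_le_card) auto
    also have "\<dots> \<le> n" unfolding partition_generators_eq using card_image_le[of "{1..n}" "class_vector n P"] by simp
    finally show "vec.dim (vec.span (partition_generators n P)) \<le> vec.dim V" by (simp add: dim_V)
  qed
  ultimately show ?thesis by blast
qed

end

section \<open>From a partition to an isotropic subspace\<close>

text \<open>
  The projection to the coordinates in \<open>T\<close> is onto.
\<close>

lemma card_le_dim_of_dual_family:
  fixes V :: "(complex, 'l::finite) vec set"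
  assumes "\<And>s. s \<in> T \<Longrightarrow> b s \<in> V"
    "\<And>s t. s \<in> T \<Longrightarrow> t \<in> T \<Longrightarrow> b s $ t = (if s = t then 1 else 0)"
  shows "card T \<le> vec.dim V"
proof -
  let ?A = "(\<lambda>t. axis t 1 :: (complex, 'l) vec) ` T"
  have "?A \<subseteq> cart_basis" by (auto simp: cart_basis_def)
  then have "vec.independent ?A"
    using vec.independent_mono independent_cart_basis by blast
  then have "vec.dim ?A = card ?A" by (rule vec.dim_eq_card_independent)
  moreover have "card ?A = card T" by (intro card_image) (auto simp: inj_on_def axis_eq_axis)
  moreover have "axis s 1 = coordinate_projection T (b s)" if "s \<in> T" for s
    using assms(2)[OF that] that by (auto simp: coordinate_projection_def vec_eq_iff axis_def)
  then have "?A \<subseteq> coordinate_projection T ` V" using assms(1) by blast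
  then have "vec.dim ?A \<le> vec.dim (coordinate_projection T ` V)" by (rule vec.dim_subset)
  moreover have "\<dots> \<le> vec.dim V" by (rule vec.dim_image_le[OF linear_coordinate_projection])
  ultimately show ?thesis by simp
qed

locale pencil_innc_arrangement = generic_innc_arrangement H \<alpha> n
  for H :: "'l::{finite,linorder} \<Rightarrow> (complex ^ 'm) set set"
    and \<alpha> :: "'l \<Rightarrow> complex ^ 'm"
    and n :: nat +
  fixes P :: "nat \<Rightarrow> 'l set"
  assumes pencil: "pencil_partition \<alpha> n P"
begin

definition class_index :: "'l \<Rightarrow> nat" where
  "class_index j = (SOME i. i \<in> {1..n+1} \<and> j \<in> P i)"

lemma class_index: "class_index j \<in> {1..n+1}" "j \<in> P (class_index j)"
proof -
  have "j \<in> \<Union>(P ` {1..n+1})"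
    using pencil by (auto simp: pencil_partition_def partition_on_def)
  then have "\<exists>i. i \<in> {1..n+1} \<and> j \<in> P i" by blast
  then have "class_index j \<in> {1..n+1} \<and> j \<in> P (class_index j)"
    unfolding class_index_def by (rule someI_ex)
  then show "class_index j \<in> {1..n+1}" "j \<in> P (class_index j)" by auto
qed

lemma in_class_iff:
  assumes "i \<in> {1..n+1}"
  shows "j \<in> P i \<longleftrightarrow> class_index j = i"
proof
  assume "j \<in> P i"
  then have "\<not> disjnt (P i) (P (class_index j))"
    using class_index(2)[of j] by (auto simp: disjnt_def)
  moreover have "pairwise disjnt (P ` {1..n+1})" "inj_on P {1..n+1}"
    using pencil by (auto simp: pencil_partition_def partition_on_def disjoint_def pairwise_def disjnt_def)
  ultimately have "P i = P (class_index j)"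
    using assms class_index(1)[of j] unfolding pairwise_def by blast
  then show "class_index j = i"
    using \<open>inj_on P {1..n+1}\<close> assms class_index(1)[of j] by (metis inj_onD)
qed (use class_index(2) in blast)

lemma class_nonempty:
  assumes "i \<in> {1..n+1}"
  obtains j where "class_index j = i"
proof -
  have "P i \<noteq> {}" using pencil assms by (auto simp: pencil_partition_def partition_on_def)
  then show ?thesis using that in_class_iff[OF assms] by auto
qed

lemma class_vector_nth_class_index:
  assumes "i \<in> {1..n+1}"
  shows "class_vector n P i $ j =
     (if class_index j = i then 1 else 0) - (if class_index j = n + 1 then 1 else 0)"
  using in_class_iff[OF assms, of j] in_class_iff[of "n + 1" j] by (simp add: class_vector_nth)

abbreviation pencil_space :: "(complex, 'l) vec set" where
  "pencil_space \<equiv> vec.span (partition_generators n P)"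

lemma class_vector_in_pencil_space:
  assumes "i \<in> {1..n+1}"
  shows "class_vector n P i \<in> pencil_space"
proof (cases "i = n + 1")
  case True
  then have "class_vector n P i = 0" by (simp add: class_vector_def)
  then show ?thesis by (simp add: vec.span_zero)
next
  case False
  then show ?thesis
    using assms unfolding partition_generators_eq by (intro vec.span_base imageI) auto
qed

lemma pencil_space_constant_on_classes:
  assumes "v \<in> pencil_space" "class_index j = class_index k"
  shows "v $ j = v $ k"
  using assms(1)
proof (induction rule: vec.span_induct_alt)
  case (step c x y)
  then obtain i where "i \<in> {1..n}" "x = class_vector n P i"
    unfolding partition_generators_eq by blast
  then have "x $ j = x $ k"
    using assms(2) by (simp add: class_vector_nth_class_index)
  then show ?case using step by simp
qed simp

lemma dim_pencil_space: "vec.dim pencil_space = n"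
proof (rule antisym)
  have "vec.dim pencil_space \<le> card (partition_generators n P)"
    unfolding partition_generators_eq by (intro vec.dim_le_card) auto
  also have "\<dots> \<le> n"
    unfolding partition_generators_eq using card_image_le[of "{1..n}" "class_vector n P"] by simp
  finally show "vec.dim pencil_space \<le> n" .
  have "\<forall>i\<in>{1..n}. \<exists>j. class_index j = i"
    using class_nonempty by (metis Suc_eq_plus1 atLeastAtMost_iff le_SucI)
  then obtain e where e: "\<And>i. i \<in> {1..n} \<Longrightarrow> class_index (e i) = i" by metis
  have inj: "inj_on e {1..n}" by (rule inj_on_inverseI) (rule e)
  have "card (e ` {1..n}) \<le> vec.dim pencil_space"
  proof (rule card_le_dim_of_dual_family)
    show "class_vector n P (class_index s) \<in> pencil_space" for s
      using class_vector_in_pencil_space class_index(1) by blast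
    show "class_vector n P (class_index s) $ t = (if s = t then 1 else 0)"
      if st: "s \<in> e ` {1..n}" "t \<in> e ` {1..n}" for s t
    proof -
      obtain i k where ik: "i \<in> {1..n}" "k \<in> {1..n}" "s = e i" "t = e k" using st by blast
      then have "s = t \<longleftrightarrow> class_index t = class_index s" using e by metis
      moreover have "class_index t \<noteq> n + 1" using e[OF ik(2)] ik by simp
      ultimately show ?thesis
        by (simp add: class_vector_nth_class_index[OF class_index(1)])
    qed
  qed
  then show "n \<le> vec.dim pencil_space" using card_image[OF inj] by simp
qed

text \<open>
  At a common zero of \<open>T\<close> the relation reduces to the product of the missing class, so some form of that
  class vanishes there too; \<open>n + 1\<close> forms with a common zero are dependent.
\<close>

lemma transversal_extends_to_circuit:
  assumes T: "card T = n" "inj_on class_index T"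
  obtains s where "s \<notin> T" "circuit (insert s T)" "inj_on class_index (insert s T)"
proof -
  have sub: "class_index ` T \<subseteq> {1..n+1}" using class_index(1) by blast
  then have "card ({1..n+1} - class_index ` T) = 1"
    using card_image[OF T(2)] T(1) by (simp add: card_Diff_subset)
  then obtain q where q: "{1..n+1} - class_index ` T = {q}" by (rule card_1_singletonE)
  obtain z where z: "z \<noteq> 0" "T \<subseteq> vanishing z"
    using exists_common_zero[of T] T(1) by auto
  obtain a where a: "\<And>i. i \<in> {1..n+1} \<Longrightarrow> a i \<noteq> (0 :: complex)"
    "(\<Sum>i=1..n+1. a i * (\<Prod>j\<in>P i. lin_form (\<alpha> j) z)) = 0"
    using pencil unfolding pencil_partition_def by blast
  have van: "a i * (\<Prod>j\<in>P i. lin_form (\<alpha> j) z) = 0" if "i \<in> {1..n+1} - {q}" for i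
  proof -
    have "i \<in> class_index ` T" using that q by blast
    then obtain t where "t \<in> T" "i = class_index t" by blast
    then have "t \<in> P i" "lin_form (\<alpha> t) z = 0"
      using z(2) class_index(2) by (auto simp: vanishing_def)
    then have "(\<Prod>j\<in>P i. lin_form (\<alpha> j) z) = 0" by (intro prod_zero) auto
    then show ?thesis by simp
  qed
  have qI: "q \<in> {1..n+1}" "q \<notin> class_index ` T" using q by blast+
  have "a q * (\<Prod>j\<in>P q. lin_form (\<alpha> j) z) = 0"
    using a(2) sum.remove[OF _ qI(1), of "\<lambda>i. a i * (\<Prod>j\<in>P i. lin_form (\<alpha> j) z)"] van by simp
  then obtain s where s: "s \<in> P q" "lin_form (\<alpha> s) z = 0"
    using a(1)[OF qI(1)] by auto
  have cs: "class_index s \<notin> class_index ` T" using s(1) qI in_class_iff by auto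
  then have sT: "s \<notin> T" by blast
  have sub: "insert s T \<subseteq> vanishing z" using s(2) z(2) by (simp add: vanishing_def)
  have "dependent_forms \<alpha> (insert s T)"
  proof (rule ccontr)
    let ?D = "{z. \<forall>s\<in>insert s T. lin_form (\<alpha> s) z = 0}"
    assume "\<not> dependent_forms \<alpha> (insert s T)"
    then have "vec.dim ?D + card (insert s T) \<le> CARD('m)"
      by (intro dim_common_kernel_le) auto
    then have "vec.dim ?D = 0"
      using sT T(1) card_coordinates by simp
    then have "?D \<subseteq> {0}" by simp
    moreover have "z \<in> ?D" using sub by (auto simp: vanishing_def)
    ultimately show False using z(1) by blast
  qed
  then have "circuit (insert s T)" by (rule dependent_forms_circuit[OF z(1) sub])
  moreover have "inj_on class_index (insert s T)"
    using T(2) cs sT by auto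
  ultimately show ?thesis using that sT by blast
qed

lemma ext_prod_nth_nontransversal:
  assumes "set vs \<subseteq> pencil_space" "card T = length vs" "\<not> inj_on class_index T"
  shows "ext_prod vs $ T = 0"
proof -
  obtain s t where st: "s \<in> T" "t \<in> T" "s \<noteq> t" "class_index s = class_index t"
    using assms(3) by (auto simp: inj_on_def)
  show ?thesis
    using ext_prod_nth_equal_coordinates[OF st(1-3) _ assms(2)]
      pencil_space_constant_on_classes[OF _ st(4)] assms(1) by blast
qed

text \<open>
  A circuit that meets every class once carries, up to restriction, the same vectors as the classes:
  the difference of two of its generators agrees on it with a vector of the space, whose product with
  the \<open>n\<close> factors is zero for reasons of dimension.  On any other circuit all coefficients vanish,
  because an \<open>n\<close>-subset from different classes would have to lie in a circuit of the first kind.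
\<close>

lemma ext_prod_circuit_condition:
  assumes vs: "set vs \<subseteq> pencil_space" "length vs = n"
  shows "circuit_condition (ext_prod vs)"
proof (rule circuit_conditionI)
  let ?w = "ext_prod vs"
  show "?w $ T = 0" if "card T < n" for T
    using that vs(2) by (intro ext_prod_nth_card) auto
  show "?w $ T = 0" if T: "card T = n" "\<And>S. circuit S \<Longrightarrow> \<not> T \<subseteq> S" for T
  proof (rule ext_prod_nth_nontransversal[OF vs(1)])
    show "card T = length vs" using T(1) vs(2) by simp
    show "\<not> inj_on class_index T"
      using transversal_extends_to_circuit[OF T(1)] T(2) by blast
  qed
  fix S s t assume S: "circuit S" and s: "s \<in> S" and t: "t \<in> S"
  show "wedge (ext_gen s) ?w $ S = wedge (ext_gen t) ?w $ S"
  proof (cases "inj_on class_index S")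
    case True
    define v where "v = class_vector n P (class_index s) - class_vector n P (class_index t)"
    have "v \<in> pencil_space"
      unfolding v_def using class_vector_in_pencil_space class_index(1) by (intro vec.span_diff) blast+
    then have "wedge (ext_vec v) ?w = 0"
      using wedge_ext_prod_eq_0[OF dim_pencil_space] vs by blast
    moreover have "(- 1 *s axis t 1 + axis s 1) $ i = v $ i" if i: "i \<in> S" for i
    proof -
      have "class_index i = class_index s \<longleftrightarrow> i = s" "class_index i = class_index t \<longleftrightarrow> i = t"
        using True i s t by (auto simp: inj_on_def)
      then show ?thesis
        by (simp add: v_def class_vector_nth_class_index[OF class_index(1)] axis_def)
    qed
    ultimately have "wedge (ext_vec (- 1 *s axis t 1 + axis s 1)) ?w $ S = 0"
      by (intro ext_prod_restrict_eq_0) auto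
    then show ?thesis
      unfolding ext_vec_add_scale ext_vec_axis wedge_add_left wedge_scale_left by simp
  next
    case False
    have "?w $ (S - {u}) = 0" if u: "u \<in> S" for u
    proof (rule ext_prod_nth_nontransversal[OF vs(1)])
      have card: "card (S - {u}) = n" using card_circuit_minus[OF S u] .
      then show "card (S - {u}) = length vs" using vs(2) by simp
      show "\<not> inj_on class_index (S - {u})"
      proof
        assume "inj_on class_index (S - {u})"
        then obtain k where k: "circuit (insert k (S - {u}))" "inj_on class_index (insert k (S - {u}))"
          using transversal_extends_to_circuit[OF card] by blast
        have "S = insert k (S - {u})"
          by (rule circuit_unique[OF S k(1) _ _ card]) auto
        then show False using k(2) False by simp
      qed
    qed
    then show ?thesis using s t by (simp add: wedge_ext_gen_nth)
  qed
qed

lemma n_pos: "n > 0"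
proof (rule ccontr)
  assume "\<not> n > 0"
  then have "card ({} :: 'l set) = n" by simp
  then obtain s where "circuit (insert s {})"
    by (rule transversal_extends_to_circuit) auto
  then show False using circuit_imp_ge_2 \<open>\<not> n > 0\<close> by fastforce
qed

theorem full_isotropic_pencil_space: "full_isotropic H n pencil_space"
  unfolding full_isotropic_def isotropic_iff
proof (intro conjI allI impI)
  show "vec.subspace pencil_space" by (rule vec.subspace_span)
  show "vec.dim pencil_space = n" by (rule dim_pencil_space)
  show "ext_prod vs \<in> os_ideal H" if "length vs = n \<and> set vs \<subseteq> pencil_space" for vs
  proof (rule homogeneous_in_os_ideal)
    show "circuit_condition (ext_prod vs)" using that ext_prod_circuit_condition by blast
    show "ext_prod vs $ T = 0" if "card T \<noteq> n" for T
      using that \<open>length vs = n \<and> set vs \<subseteq> pencil_space\<close> by (intro ext_prod_nth_card) auto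
  qed
  show "\<not> pencil_space \<subseteq> coordinate_hyperplane j" for j
  proof -
    define i where "i = (if class_index j = n + 1 then 1 else class_index j)"
    have i: "i \<in> {1..n+1}" using class_index(1)[of j] by (simp add: i_def)
    have "class_vector n P i $ j \<noteq> 0"
      using n_pos by (simp add: class_vector_nth_class_index[OF i]) (auto simp: i_def)
    then show ?thesis
      using class_vector_in_pencil_space[OF i] by (auto simp: coordinate_hyperplane_def)
  qed
qed

end

section \<open>The equivalence\<close>

theorem theorem10:
  fixes H :: "'l::{finite,linorder} \<Rightarrow> (complex ^ 'm) set set"
    and \<alpha> :: "'l \<Rightarrow> complex ^ 'm"
    and n :: nat
  assumes "CARD('m) = n + 1"
    and "inj H"
    and "\<And>j. defines_hyperplane (\<alpha> j) (H j)"
    and "INNC H"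
    and "\<And>p. p \<in> non_normal_crossings H \<Longrightarrow>
           card (through H p) = n + 1 \<and> hyperplane_meet H (through H p) = {p}"
  shows "((\<exists>V. full_isotropic H n V) \<longleftrightarrow> (\<exists>P. pencil_partition \<alpha> n P)) \<and>
         (\<forall>V. full_isotropic H n V \<longrightarrow>
            (\<exists>P. pencil_partition \<alpha> n P \<and> V = vec.span (partition_generators n P))) \<and>
         (\<forall>P. pencil_partition \<alpha> n P \<longrightarrow> full_isotropic H n (vec.span (partition_generators n P)))"
proof -
  interpret generic_innc_arrangement H \<alpha> n
    by unfold_locales (rule assms; assumption)+
  have "\<exists>P. pencil_partition \<alpha> n P \<and> V = vec.span (partition_generators n P)"
    if "full_isotropic H n V" for V
  proof -
    interpret isotropic_innc_arrangement H \<alpha> n V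
      by unfold_locales (rule that)
    show ?thesis by (rule exists_pencil_partition)
  qed
  moreover have "full_isotropic H n (vec.span (partition_generators n P))"
    if "pencil_partition \<alpha> n P" for P
  proof -
    interpret pencil_innc_arrangement H \<alpha> n P
      by unfold_locales (rule that)
    show ?thesis by (rule full_isotropic_pencil_space)
  qed
  ultimately show ?thesis by blast
qed

end
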